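(* Let $\Omega\subseteq\mathbb{R}^N$ be a region, $m\ge1$ an integer, and suppose $\Omega$ is $m$-regular. Let $H_m$ be the polyharmonic operator of order $2m$ in $L^2(\Omega)$ with Dirichlet boundary conditions. Then $0\notin\operatorname{spec}(H_m)$ if and only if the inradius $\sup_{x\in\Omega}d(x)$ of $\Omega$ is finite.
   Context: $d(x)=\min\{|y-x|:y\notin\Omega\}$. $H_m$ is the non-negative self-adjoint operator associated with the closure (domain $W_0^{m,2}(\Omega)$) of the form $Q_m(f)=\langle(-\Delta)^m f,f\rangle$ on $C_c^\infty(\Omega)$. For $\omega\in S^{N-1}$, $d_\omega(x)=\min\{|s|:x+s\omega\notin\Omega\}$, and $a_m(x)=\left[\int_{S^{N-1}}d_\omega(x)^{-2m}\,d^{N-1}\omega\right]^{-1/(2m)}$ with $d^{N-1}\omega$ normalized surface measure. $\Omega$ is $m$-regular if there is $k_m<\infty$ with $d(x)\le a_m(x)\le k_m d(x)$ for all $x\in\Omega$. *)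

theory Defs
  imports "HOL-Analysis.Analysis"
begin

fun iter_dd :: "'a::euclidean_space list \<Rightarrow> ('a \<Rightarrow> real) \<Rightarrow> 'a \<Rightarrow> real" where
  "iter_dd [] f = f"
| "iter_dd (v # vs) f = (\<lambda>x. frechet_derivative (iter_dd vs f) (at x) v)"

definition smooth_on :: "'a::euclidean_space set \<Rightarrow> ('a \<Rightarrow> real) \<Rightarrow> bool" where
  "smooth_on U f \<longleftrightarrow> (\<forall>vs. \<forall>x\<in>U. iter_dd vs f differentiable (at x))"

text \<open>Test functions C_c^infinity(Omega) (extended by zero to the whole space).\<close>
definition test_fun :: "'a::euclidean_space set \<Rightarrow> ('a \<Rightarrow> real) \<Rightarrow> bool" where
  "test_fun \<Omega> f \<longleftrightarrow> smooth_on UNIV f \<and> compact (closure {x. f x \<noteq> 0})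
      \<and> closure {x. f x \<noteq> 0} \<subseteq> \<Omega>"

definition laplacian :: "('a::euclidean_space \<Rightarrow> real) \<Rightarrow> 'a \<Rightarrow> real" where
  "laplacian f x = (\<Sum>b\<in>Basis. iter_dd [b, b] f x)"

definition polylap :: "nat \<Rightarrow> ('a::euclidean_space \<Rightarrow> real) \<Rightarrow> 'a \<Rightarrow> real" where
  "polylap m f = ((\<lambda>g x. - laplacian g x) ^^ m) f"

definition L2 :: "'a::euclidean_space set \<Rightarrow> ('a \<Rightarrow> real) \<Rightarrow> bool" where
  "L2 \<Omega> f \<longleftrightarrow> f \<in> borel_measurable (lebesgue_on \<Omega>) \<and> set_integrable lebesgue \<Omega> (\<lambda>x. (f x)\<^sup>2)"

definition L2_inner :: "'a::euclidean_space set \<Rightarrow> ('a \<Rightarrow> real) \<Rightarrow> ('a \<Rightarrow> real) \<Rightarrow> real" where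
  "L2_inner \<Omega> f g = (LINT x:\<Omega>|lebesgue. f x * g x)"

definition L2_norm :: "'a::euclidean_space set \<Rightarrow> ('a \<Rightarrow> real) \<Rightarrow> real" where
  "L2_norm \<Omega> f = sqrt (L2_inner \<Omega> f f)"

definition Qm :: "'a::euclidean_space set \<Rightarrow> nat \<Rightarrow> ('a \<Rightarrow> real) \<Rightarrow> ('a \<Rightarrow> real) \<Rightarrow> real" where
  "Qm \<Omega> m \<phi> \<psi> = L2_inner \<Omega> (polylap m \<phi>) \<psi>"

definition form_approx :: "'a::euclidean_space set \<Rightarrow> nat \<Rightarrow> (nat \<Rightarrow> 'a \<Rightarrow> real) \<Rightarrow> ('a \<Rightarrow> real) \<Rightarrow> bool" where
  "form_approx \<Omega> m \<phi> f \<longleftrightarrow> (\<forall>n. test_fun \<Omega> (\<phi> n))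
     \<and> (\<lambda>n. L2_norm \<Omega> (\<lambda>x. \<phi> n x - f x)) \<longlonglongrightarrow> 0
     \<and> (\<forall>e>0. \<exists>M. \<forall>n\<ge>M. \<forall>k\<ge>M. Qm \<Omega> m (\<lambda>x. \<phi> n x - \<phi> k x) (\<lambda>x. \<phi> n x - \<phi> k x) < e)"

text \<open>Domain of the closed form (= W_0^{m,2}(Omega)).\<close>
definition form_dom :: "'a::euclidean_space set \<Rightarrow> nat \<Rightarrow> ('a \<Rightarrow> real) \<Rightarrow> bool" where
  "form_dom \<Omega> m f \<longleftrightarrow> L2 \<Omega> f \<and> (\<exists>\<phi>. form_approx \<Omega> m \<phi> f)"

definition form_val :: "'a::euclidean_space set \<Rightarrow> nat \<Rightarrow> ('a \<Rightarrow> real) \<Rightarrow> ('a \<Rightarrow> real) \<Rightarrow> real \<Rightarrow> bool" where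
  "form_val \<Omega> m f h c \<longleftrightarrow>
     (\<forall>\<phi> \<psi>. form_approx \<Omega> m \<phi> f \<longrightarrow> form_approx \<Omega> m \<psi> h \<longrightarrow> (\<lambda>n. Qm \<Omega> m (\<phi> n) (\<psi> n)) \<longlonglongrightarrow> c)"

text \<open>Graph of the self-adjoint operator H_m associated with the closed form:
  H_m f = g iff f in the form domain and q(f,h) = <g,h> for all h in the form domain.\<close>
definition Hm :: "'a::euclidean_space set \<Rightarrow> nat \<Rightarrow> ('a \<Rightarrow> real) \<Rightarrow> ('a \<Rightarrow> real) \<Rightarrow> bool" where
  "Hm \<Omega> m f g \<longleftrightarrow> form_dom \<Omega> m f \<and> L2 \<Omega> g
     \<and> (\<forall>h. form_dom \<Omega> m h \<longrightarrow> form_val \<Omega> m f h (L2_inner \<Omega> g h))"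

text \<open>0 is in the resolvent set of H_m: H_m is injective (modulo null functions) and has
  an everywhere defined bounded inverse on L^2(Omega).\<close>
definition zero_notin_spec :: "'a::euclidean_space set \<Rightarrow> nat \<Rightarrow> bool" where
  "zero_notin_spec \<Omega> m \<longleftrightarrow>
     (\<forall>f. Hm \<Omega> m f (\<lambda>_. 0) \<longrightarrow> L2_norm \<Omega> f = 0)
     \<and> (\<exists>C. \<forall>g. L2 \<Omega> g \<longrightarrow> (\<exists>f. Hm \<Omega> m f g \<and> L2_norm \<Omega> f \<le> C * L2_norm \<Omega> g))"

text \<open>d(x) = distance to the complement (infinity if the complement is empty).\<close>
definition dist_bdry :: "'a::euclidean_space set \<Rightarrow> 'a \<Rightarrow> ennreal" where
  "dist_bdry \<Omega> x = Inf {ennreal (dist x y) | y. y \<notin> \<Omega>}"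

text \<open>d_omega(x) = min {|s| : x + s omega not in Omega} (infinity if no such s).\<close>
definition dist_dir :: "'a::euclidean_space set \<Rightarrow> 'a \<Rightarrow> 'a \<Rightarrow> ennreal" where
  "dist_dir \<Omega> \<omega> x = Inf {ennreal \<bar>s\<bar> | s. x + s *\<^sub>R \<omega> \<notin> \<Omega>}"

text \<open>Normalized surface measure on the unit sphere, realised as the cone measure:
  push-forward of the uniform probability on the unit ball under x / |x|.\<close>
definition sphere_measure :: "'a::euclidean_space measure" where
  "sphere_measure = distr (uniform_measure lborel (ball 0 1)) borel sgn"

definition am_integral :: "'a::euclidean_space set \<Rightarrow> nat \<Rightarrow> 'a \<Rightarrow> ennreal" where
  "am_integral \<Omega> m x = (\<integral>\<^sup>+ \<omega>. inverse (dist_dir \<Omega> \<omega> x ^ (2 * m)) \<partial>sphere_measure)"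

definition a_m :: "'a::euclidean_space set \<Rightarrow> nat \<Rightarrow> 'a \<Rightarrow> ennreal" where
  "a_m \<Omega> m x = (let I = am_integral \<Omega> m x in
      if I = 0 then \<infinity> else if I = \<infinity> then 0
      else ennreal (enn2real I powr (- 1 / (2 * real m))))"

definition m_regular :: "'a::euclidean_space set \<Rightarrow> nat \<Rightarrow> bool" where
  "m_regular \<Omega> m \<longleftrightarrow> (\<exists>k::real. \<forall>x\<in>\<Omega>.
      dist_bdry \<Omega> x \<le> a_m \<Omega> m x \<and> a_m \<Omega> m x \<le> ennreal k * dist_bdry \<Omega> x)"

definition finite_inradius :: "'a::euclidean_space set \<Rightarrow> bool" where
  "finite_inradius \<Omega> \<longleftrightarrow> (SUP x\<in>\<Omega>. dist_bdry \<Omega> x) < \<infinity>"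

end

theory Submission
  imports Defs
begin

text \<open>
  Write \<open>q(f) = \<langle>(-\<Delta>)\<^sup>m f, f\<rangle>\<close>; both implications go through the inequality \<open>\<parallel>f\<parallel>\<^sup>2 \<le> C q(f)\<close> on test
  functions, which is equivalent to \<open>0\<close> lying in the resolvent set.

  If the inradius is infinite, a bump function rescaled to balls of radius \<open>R \<rightarrow> \<infinity>\<close> inside \<open>\<Omega>\<close> has
  \<open>q(f) / \<parallel>f\<parallel>\<^sup>2\<close> of order \<open>R\<^bsup>-2m\<^esup>\<close>. If it is finite, \<open>m\<close>-regularity provides \<open>L\<close> and \<open>\<sigma> > 0\<close> such that
  from every point of \<open>\<Omega>\<close> a proportion at least \<open>\<sigma>\<close> of the directions leaves \<open>\<Omega>\<close> within distance \<open>L\<close>.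
  Along such a direction \<open>\<omega>\<close> a test function vanishes within distance \<open>L\<close>, so the fundamental theorem
  of calculus bounds it by \<open>\<partial>\<^sub>\<omega>\<^sup>m f\<close>, and \<open>\<parallel>\<partial>\<^sub>\<omega>\<^sup>m f\<parallel>\<^sup>2 \<le> q(f)\<close>. Averaging
  over \<open>\<omega>\<close> gives the inequality.
\<close>

subsection \<open>Directional derivatives of smooth functions\<close>

text \<open>No spectral theory enters the passage between the spectrum and the inequality.
  Coercivity on test functions makes a minimising sequence of q(u) - 2 <g, u> Cauchy in the form,
  and its limit solves H_m f = g; conversely a bounded inverse yields the inequality by
  Cauchy-Schwarz for the form. The delicate point is that the graph of H_m quantifies over every
  approximating sequence, so limits must be shown independent of the sequence, which is closability.

  The bound of the m-th derivative along \<omega> by q, immediate on the Fourier side, comes here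
  from integration by parts: q is rewritten as the sum of the squared norms of all m-fold coordinate
  derivatives, and one derivative is exchanged at a time.

  In the directional estimate the obstacle is that the set of good base points depends on \<omega>.
  It is stable under moving towards the exit point, so each of the m integrations stays inside it;
  and as all derivatives of a test function vanish off \<Omega>, one exit point serves at every
  order.\<close>

definition dderiv :: "'a::euclidean_space \<Rightarrow> ('a \<Rightarrow> real) \<Rightarrow> 'a \<Rightarrow> real" where
  "dderiv v f = (\<lambda>x. frechet_derivative f (at x) v)"

abbreviation smooth :: "('a::euclidean_space \<Rightarrow> real) \<Rightarrow> bool" where
  "smooth f \<equiv> smooth_on UNIV f"

lemma iter_dd_Cons: "iter_dd (v # vs) f = dderiv v (iter_dd vs f)"
  by (simp add: dderiv_def)

text \<open>\<open>iter_dd\<close> peels the outermost derivative off the list; closure of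
  smoothness under one derivative needs the innermost one instead.\<close>

lemma iter_dd_snoc: "iter_dd (vs @ [v]) f = iter_dd vs (dderiv v f)"
  by (induction vs) (simp_all add: dderiv_def)

lemma smooth_has_derivative:
  assumes "smooth f" shows "(f has_derivative (\<lambda>v. dderiv v f x)) (at x)"
proof -
  have "iter_dd [] f differentiable at x"
    using assms unfolding smooth_on_def by blast
  then show ?thesis
    by (simp add: frechet_derivative_works dderiv_def)
qed

lemma smooth_dderiv: "smooth f \<Longrightarrow> smooth (dderiv v f)"
  unfolding smooth_on_def by (metis iter_dd_snoc)

lemma dderiv_unique: "(f has_derivative D) (at x) \<Longrightarrow> dderiv v f x = D v"
  unfolding dderiv_def using frechet_derivative_at by metis

text \<open>A set whose members are differentiable with directional derivatives again in the set
  contains every iterated derivative of its members. Linear combinations, rescalings and bumps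
  therefore need no formula for higher derivatives.\<close>

lemma smooth_coinduct:
  assumes "f \<in> S"
    and "\<And>g. g \<in> S \<Longrightarrow> \<exists>D. \<forall>x. (g has_derivative (\<lambda>v. D v x)) (at x) \<and> (\<forall>v. D v \<in> S)"
  shows "smooth f"
proof -
  have dS: "dderiv v g \<in> S" if g: "g \<in> S" for v g
  proof -
    obtain D where D: "\<And>x. (g has_derivative (\<lambda>v. D v x)) (at x)" "\<And>v. D v \<in> S"
      using assms(2)[OF g] by blast
    then have "dderiv v g = D v"
      using dderiv_unique by blast
    then show ?thesis using D by simp
  qed
  have "iter_dd vs f \<in> S" for vs
    by (induction vs) (auto simp: assms(1) iter_dd_Cons dS simp del: iter_dd.simps(2))
  then show ?thesis
    unfolding smooth_on_def differentiable_def using assms(2) by blast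
qed

lemma dderiv_lincomb:
  assumes "smooth f" "smooth g"
  shows "dderiv v (\<lambda>x. a * f x + b * g x) = (\<lambda>x. a * dderiv v f x + b * dderiv v g x)"
proof
  fix x
  have "((\<lambda>x. a * f x + b * g x) has_derivative (\<lambda>v. a * dderiv v f x + b * dderiv v g x)) (at x)"
    by (intro has_derivative_add has_derivative_mult_right smooth_has_derivative assms)
  then show "dderiv v (\<lambda>x. a * f x + b * g x) x = a * dderiv v f x + b * dderiv v g x"
    by (rule dderiv_unique)
qed

lemma smooth_lincomb:
  assumes "smooth f" "smooth g" shows "smooth (\<lambda>x. a * f x + b * g x)"
proof (rule smooth_coinduct[where S = "{h. \<exists>f g. smooth f \<and> smooth g \<and> h = (\<lambda>x. a * f x + b * g x)}"], goal_cases)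
  case 1
  then show ?case using assms by blast
next
  case (2 h)
  then obtain f g where h: "smooth f" "smooth g" "h = (\<lambda>x. a * f x + b * g x)" by blast
  show ?case
  proof (intro exI[of _ "\<lambda>v x. a * dderiv v f x + b * dderiv v g x"] allI conjI CollectI)
    show "(h has_derivative (\<lambda>v. a * dderiv v f x + b * dderiv v g x)) (at x)" for x
      unfolding h(3)
      by (intro has_derivative_add has_derivative_mult_right smooth_has_derivative h)
    show "\<exists>f' g'. smooth f' \<and> smooth g' \<and>
        (\<lambda>x. a * dderiv v f x + b * dderiv v g x) = (\<lambda>x. a * f' x + b * g' x)" for v
      using h(1,2) smooth_dderiv by blast
  qed
qed

lemma smooth_continuous: "smooth f \<Longrightarrow> continuous_on S f"
  by (meson continuous_at_imp_continuous_on has_derivative_continuous smooth_has_derivative)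

lemma smooth_line_derivative:
  assumes "smooth f"
  shows "((\<lambda>t. f (x + t *\<^sub>R v)) has_real_derivative dderiv v f (x + t *\<^sub>R v)) (at t within S)"
proof -
  have "((\<lambda>t. x + t *\<^sub>R v) has_derivative (\<lambda>t. t *\<^sub>R v)) (at t within S)"
    by (auto intro!: derivative_eq_intros)
  from has_derivative_compose[OF this smooth_has_derivative[OF assms]]
  have "((\<lambda>t. f (x + t *\<^sub>R v)) has_derivative (\<lambda>s. dderiv (s *\<^sub>R v) f (x + t *\<^sub>R v))) (at t within S)" .
  moreover have "dderiv (s *\<^sub>R v) f y = dderiv v f y * s" for s y
    using linear_scale[OF has_derivative_linear[OF smooth_has_derivative[OF assms, of y]]] by simp
  ultimately show ?thesis
    by (simp add: has_field_derivative_def)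
qed

text \<open>Differentiate \<open>f (x + r w + s v) = f (x + r w) + \<integral>\<^sub>0\<^sup>s (\<partial>\<^sub>v f) (x + r w + \<sigma> v) d\<sigma>\<close> under the
  integral sign in \<open>r\<close>, then in \<open>s\<close>.\<close>
lemma dderiv_commute:
  fixes f :: "'a::euclidean_space \<Rightarrow> real"
  assumes "smooth f"
  shows "dderiv v (dderiv w f) = dderiv w (dderiv v f)"
proof
  fix x :: 'a
  define h where "h = dderiv w (dderiv v f)"
  have h: "smooth h" by (simp add: h_def assms smooth_dderiv)
  have comp_cont: "continuous_on S (\<lambda>z. g (k z))" if "smooth g" "continuous_on S k" for S g and k :: "'b::topological_space \<Rightarrow> 'a"
    using continuous_on_compose2[OF smooth_continuous[OF that(1), of UNIV] that(2)] by simp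
  have key: "dderiv w f (x + s *\<^sub>R v) = dderiv w f x + integral {0..s} (\<lambda>\<sigma>. h (x + \<sigma> *\<^sub>R v))" if "s \<ge> 0" for s
  proof -
    have ftc: "f ((x + s *\<^sub>R v) + r *\<^sub>R w) = f (x + r *\<^sub>R w) + integral (cbox 0 s) (\<lambda>\<sigma>. dderiv v f ((x + \<sigma> *\<^sub>R v) + r *\<^sub>R w))" for r
    proof -
      have "((\<lambda>\<sigma>. dderiv v f ((x + r *\<^sub>R w) + \<sigma> *\<^sub>R v)) has_integral
          (f ((x + r *\<^sub>R w) + s *\<^sub>R v) - f ((x + r *\<^sub>R w) + 0 *\<^sub>R v))) {0..s}"
        by (rule fundamental_theorem_of_calculus[OF that])
           (use smooth_line_derivative[OF assms] in \<open>simp add: has_real_derivative_iff_has_vector_derivative\<close>)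
      then show ?thesis
        by (simp add: integral_unique algebra_simps)
    qed
    have "((\<lambda>r. integral (cbox 0 s) (\<lambda>\<sigma>. dderiv v f ((x + \<sigma> *\<^sub>R v) + r *\<^sub>R w))) has_real_derivative
        integral (cbox 0 s) (\<lambda>\<sigma>. h ((x + \<sigma> *\<^sub>R v) + 0 *\<^sub>R w))) (at 0 within UNIV)"
    proof (rule leibniz_rule_field_derivative)
      show "((\<lambda>r. dderiv v f ((x + \<sigma> *\<^sub>R v) + r *\<^sub>R w)) has_real_derivative h ((x + \<sigma> *\<^sub>R v) + r *\<^sub>R w)) (at r within UNIV)" for r \<sigma>
        unfolding h_def by (rule smooth_line_derivative) (simp add: assms smooth_dderiv)
      show "(\<lambda>\<sigma>. dderiv v f ((x + \<sigma> *\<^sub>R v) + r *\<^sub>R w)) integrable_on cbox 0 s" for r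
        by (intro integrable_continuous comp_cont smooth_dderiv assms continuous_intros)
      show "continuous_on (UNIV \<times> cbox 0 s) (\<lambda>(r, \<sigma>). h ((x + \<sigma> *\<^sub>R v) + r *\<^sub>R w))"
        unfolding split_def by (intro comp_cont h continuous_intros)
    qed auto
    from DERIV_add[OF smooth_line_derivative[OF assms, of x w 0 UNIV] this]
    have 1: "((\<lambda>r. f ((x + s *\<^sub>R v) + r *\<^sub>R w)) has_real_derivative
        dderiv w f x + integral (cbox 0 s) (\<lambda>\<sigma>. h (x + \<sigma> *\<^sub>R v))) (at 0)"
      unfolding ftc by simp
    show ?thesis
      using DERIV_unique[OF smooth_line_derivative[OF assms, of "x + s *\<^sub>R v" w 0 UNIV] 1] by simp
  qed
  \<comment> \<open>The identity \<open>key\<close> holds for s >= 0 only, so one-sided derivatives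
    at 0 are compared. The derivative within {0..1} is unique because 0 is a limit point of that
    interval.\<close>
  have "((\<lambda>s. integral {0..s} (\<lambda>\<sigma>. h (x + \<sigma> *\<^sub>R v))) has_vector_derivative h (x + 0 *\<^sub>R v)) (at 0 within {0..1})"
    by (intro integral_has_vector_derivative comp_cont h continuous_intros) auto
  from has_vector_derivative_add[OF has_vector_derivative_const[of "dderiv w f x"] this]
  have "((\<lambda>s. dderiv w f x + integral {0..s} (\<lambda>\<sigma>. h (x + \<sigma> *\<^sub>R v))) has_vector_derivative h x) (at 0 within {0..1})"
    by simp
  then have "((\<lambda>s. dderiv w f (x + s *\<^sub>R v)) has_vector_derivative h x) (at 0 within {0..1})"
    by (rule has_vector_derivative_transform[rotated 2, where S="{0..1}"]) (simp_all add: key)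
  moreover have "((\<lambda>s. dderiv w f (x + s *\<^sub>R v)) has_vector_derivative dderiv v (dderiv w f) x) (at 0 within {0..1})"
    using smooth_line_derivative[OF smooth_dderiv[OF assms, of w], of x v 0]
    by (simp add: has_real_derivative_iff_has_vector_derivative)
  ultimately have "dderiv v (dderiv w f) x = h x"
    by (intro vector_derivative_unique_within) (auto simp: trivial_limit_within islimpt_Icc)
  then show "dderiv v (dderiv w f) x = dderiv w (dderiv v f) x"
    by (simp add: h_def)
qed

subsection \<open>Test functions\<close>

lemma test_funD: "test_fun \<Omega> f \<Longrightarrow> smooth f"
  by (simp add: test_fun_def)

lemma test_fun_mono: "test_fun \<Omega> f \<Longrightarrow> \<Omega> \<subseteq> \<Omega>' \<Longrightarrow> test_fun \<Omega>' f"
  by (auto simp: test_fun_def)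

lemma test_fun_eq_0: "test_fun \<Omega> f \<Longrightarrow> x \<notin> \<Omega> \<Longrightarrow> f x = 0"
  unfolding test_fun_def using closure_subset[of "{x. f x \<noteq> 0}"] by blast

lemma test_funI:
  assumes "smooth f" "compact K" "K \<subseteq> \<Omega>" "\<And>x. x \<notin> K \<Longrightarrow> f x = 0"
  shows "test_fun \<Omega> f"
proof -
  have "closure {x. f x \<noteq> 0} \<subseteq> K"
    using assms by (intro closure_minimal compact_imp_closed) auto
  then show ?thesis
    using assms compact_Int_closed[OF assms(2) closed_closure, of "{x. f x \<noteq> 0}"]
    by (auto simp: test_fun_def Int_absorb1)
qed

lemma test_fun_support:
  assumes "test_fun \<Omega> f"
  obtains K where "compact K" "K \<subseteq> \<Omega>" "\<And>x. x \<notin> K \<Longrightarrow> f x = 0"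
  using assms that[of "closure {x. f x \<noteq> 0}"] closure_subset[of "{x. f x \<noteq> 0}"]
  unfolding test_fun_def by blast

lemma test_fun_lincomb:
  assumes "test_fun \<Omega> f" "test_fun \<Omega> g"
  shows "test_fun \<Omega> (\<lambda>x. a * f x + b * g x)"
proof -
  obtain K where "compact K" "K \<subseteq> \<Omega>" "\<And>x. x \<notin> K \<Longrightarrow> f x = 0"
    by (rule test_fun_support[OF assms(1)]) metis
  moreover obtain K' where "compact K'" "K' \<subseteq> \<Omega>" "\<And>x. x \<notin> K' \<Longrightarrow> g x = 0"
    by (rule test_fun_support[OF assms(2)]) metis
  ultimately show ?thesis
    by (intro test_funI[OF smooth_lincomb[OF test_funD[OF assms(1)] test_funD[OF assms(2)]], of "K \<union> K'"]) auto
qed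

lemma test_fun_zero: "test_fun \<Omega> (\<lambda>x. 0)"
proof (rule test_funI[of _ "{}"])
  show "smooth (\<lambda>x::'a. 0::real)"
    by (rule smooth_coinduct[of _ "{\<lambda>x. 0}"]) (auto intro!: exI[of _ "\<lambda>v x. 0"])
qed auto

text \<open>The closure of the support has an open complement, so f vanishes in a neighbourhood of
  each point there and its derivative vanishes too.\<close>

lemma test_fun_dderiv:
  fixes f :: "'a::euclidean_space \<Rightarrow> real"
  assumes "test_fun \<Omega> f" shows "test_fun \<Omega> (dderiv v f)"
proof -
  define K where "K = closure {x. f x \<noteq> 0}"
  have K: "compact K" "K \<subseteq> \<Omega>" using assms by (auto simp: test_fun_def K_def)
  have "dderiv v f x = 0" if "x \<notin> K" for x
  proof -
    have "((\<lambda>x. 0) has_derivative (\<lambda>v. dderiv v f x)) (at x)"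
    proof (rule has_derivative_transform_within_open[OF smooth_has_derivative[OF test_funD[OF assms]]])
      show "open (- K)" by (simp add: K_def open_Compl)
      show "x \<in> - K" using that by simp
      show "f y = 0" if "y \<in> - K" for y using that closure_subset[of "{x. f x \<noteq> 0}"] unfolding K_def by blast
    qed
    then have "(\<lambda>v. dderiv v f x) = (\<lambda>v. 0)"
      using has_derivative_unique has_derivative_const by blast
    then show ?thesis by metis
  qed
  then show ?thesis
    using K by (intro test_funI[of _ K] smooth_dderiv test_funD[OF assms])
qed

subsection \<open>Integration by parts\<close>

lemma integrable_compact_support:
  fixes f :: "'a::euclidean_space \<Rightarrow> real"
  assumes "continuous_on UNIV f" "compact K" "\<And>x. x \<notin> K \<Longrightarrow> f x = 0"
  shows "integrable lborel f"
proof -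
  have "integrable lborel (\<lambda>x. indicator K x *\<^sub>R f x)"
    by (intro borel_integrable_compact assms continuous_on_subset[OF assms(1)]) auto
  also have "(\<lambda>x. indicator K x *\<^sub>R f x) = f"
    using assms(3) by (auto simp: indicator_def fun_eq_iff)
  finally show ?thesis .
qed

lemma test_fun_integrable_mult:
  fixes f g :: "'a::euclidean_space \<Rightarrow> real"
  assumes "test_fun UNIV f" "test_fun UNIV g"
  shows "integrable lborel (\<lambda>x. f x * g x)"
proof -
  obtain K where K: "compact K" "\<And>x. x \<notin> K \<Longrightarrow> f x = 0"
    by (rule test_fun_support[OF assms(1)]) metis
  show ?thesis
    using continuous_on_mult[OF smooth_continuous[OF test_funD[OF assms(1)]] smooth_continuous[OF test_funD[OF assms(2)]]]
    by (rule integrable_compact_support[OF _ K(1)]) (simp add: K)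
qed

lemma lborel_integral_translate:
  fixes F :: "'a::euclidean_space \<Rightarrow> real"
  assumes "F \<in> borel_measurable borel"
  shows "(\<integral>x. F (a + x) \<partial>lborel) = (\<integral>x. F x \<partial>lborel)"
  using integral_distr[of "(+) a" lborel borel F] assms by (simp add: lborel_distr_plus)

lemma lborel_nn_integral_translate:
  fixes F :: "'a::euclidean_space \<Rightarrow> ennreal"
  assumes "F \<in> borel_measurable borel"
  shows "(\<integral>\<^sup>+x. F (a + x) \<partial>lborel) = (\<integral>\<^sup>+x. F x \<partial>lborel)"
  using nn_integral_distr[of "(+) a" lborel borel F] assms by (simp add: lborel_distr_plus)

text \<open>The integrals of the difference quotients vanish by translation invariance.\<close>
lemma integral_derivative_eq_0:
  fixes F F' :: "'a::euclidean_space \<Rightarrow> real"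
  assumes der: "\<And>x t. ((\<lambda>t. F (x + t *\<^sub>R v)) has_real_derivative F' (x + t *\<^sub>R v)) (at t)"
    and cF: "continuous_on UNIV F" and cF': "continuous_on UNIV F'"
    and K: "compact K" "\<And>x. x \<notin> K \<Longrightarrow> F x = 0" "\<And>x. x \<notin> K \<Longrightarrow> F' x = 0"
  shows "(\<integral>x. F' x \<partial>lborel) = 0"
proof -
  have meas [measurable]: "F \<in> borel_measurable borel" "F' \<in> borel_measurable borel"
    using cF cF' by (auto intro: borel_measurable_continuous_onI)
  define h where "h n = inverse (real (Suc n))" for n
  have h: "0 < h n" "h n \<le> 1" for n by (auto simp: h_def divide_simps)
  define s where "s n x = (F (h n *\<^sub>R v + x) - F x) / h n" for n x
  obtain B where B: "\<And>x. x \<in> K \<Longrightarrow> norm (F' x) \<le> B"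
    using compact_imp_bounded[OF compact_continuous_image[OF continuous_on_subset[OF cF'] K(1)]]
    unfolding bounded_iff by auto
  have B': "norm (F' x) \<le> \<bar>B\<bar>" for x
    using B[of x] K(3)[of x] by (cases "x \<in> K") auto
  \<comment> \<open>Since \<open>h n\<close> lies in (0,1], all difference quotients vanish off the
    compact set K - [0,1] v. With the bound from the mean value theorem this gives the dominating
    function.\<close>
  define K' where "K' = (\<lambda>(k, t). k - t *\<^sub>R v) ` (K \<times> {0..1})"
  have "compact K'"
    unfolding K'_def using K(1)
    by (intro compact_continuous_image compact_Times) (auto simp: split_def intro!: continuous_intros)
  have bound: "norm (s n x) \<le> indicator K' x *\<^sub>R \<bar>B\<bar>" for n x
  proof (cases "x \<in> K'")
    case True
    obtain z where z: "F (x + h n *\<^sub>R v) - F (x + 0 *\<^sub>R v) = (h n - 0) * F' (x + z *\<^sub>R v)"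
      using MVT2[of 0 "h n" "\<lambda>t. F (x + t *\<^sub>R v)" "\<lambda>t. F' (x + t *\<^sub>R v)"] der h[of n] by blast
    then have "s n x = F' (x + z *\<^sub>R v)"
      using h[of n] by (simp add: s_def add.commute)
    then show ?thesis using B' True by simp
  next
    case False
    then have notin: "x + t *\<^sub>R v \<notin> K" if "0 \<le> t" "t \<le> 1" for t
    proof -
      have "x + t *\<^sub>R v \<in> K \<Longrightarrow> x \<in> K'"
        unfolding K'_def using that by (intro image_eqI[of _ _ "(x + t *\<^sub>R v, t)"]) auto
      then show ?thesis using False by blast
    qed
    have "F (x + h n *\<^sub>R v) = 0" "F x = 0"
      using notin[of "h n"] notin[of 0] h[of n] K(2) by auto
    then show ?thesis by (simp add: s_def add.commute False)
  qed
  have "(\<lambda>n. \<integral>x. s n x \<partial>lborel) \<longlonglongrightarrow> (\<integral>x. F' x \<partial>lborel)"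
  proof (rule integral_dominated_convergence)
    show "integrable lborel (\<lambda>x. indicator K' x *\<^sub>R \<bar>B\<bar>)"
      by (intro borel_integrable_compact \<open>compact K'\<close> continuous_intros)
    show "AE x in lborel. (\<lambda>n. s n x) \<longlonglongrightarrow> F' x"
    proof (rule AE_I2)
      fix x
      have "((\<lambda>t. (F (x + t *\<^sub>R v) - F x) / t) \<longlongrightarrow> F' x) (at 0)"
        using der[of x 0] by (simp add: has_field_derivative_iff)
      moreover have "filterlim h (at 0) sequentially"
        unfolding filterlim_at h_def using LIMSEQ_inverse_real_of_nat by auto
      ultimately show "(\<lambda>n. s n x) \<longlonglongrightarrow> F' x"
        unfolding s_def add.commute[of _ x] by (rule filterlim_compose)
    qed
    show "AE x in lborel. norm (s n x) \<le> indicator K' x *\<^sub>R \<bar>B\<bar>" for n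
      using bound by simp
    show "s n \<in> borel_measurable lborel" for n
      unfolding s_def by measurable
  qed measurable
  moreover have "(\<integral>x. s n x \<partial>lborel) = 0" for n
  proof -
    have int: "integrable lborel F"
      using integrable_compact_support cF K by blast
    have "integrable lborel (\<lambda>x. F (h n *\<^sub>R v + x))"
      using integrable_distr_eq[of "(+) (h n *\<^sub>R v)" lborel borel F] int by (simp add: lborel_distr_plus)
    then show ?thesis
      unfolding s_def using int lborel_integral_translate[OF meas(1), of "h n *\<^sub>R v"] by simp
  qed
  ultimately show ?thesis
    by (simp add: LIMSEQ_const_iff)
qed

lemma integration_by_parts:
  fixes f g :: "'a::euclidean_space \<Rightarrow> real"
  assumes f: "test_fun UNIV f" and g: "test_fun UNIV g"
  shows "(\<integral>x. dderiv v f x * g x \<partial>lborel) = - (\<integral>x. f x * dderiv v g x \<partial>lborel)"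
proof -
  note [simp] = test_funD[OF f] test_funD[OF g] smooth_dderiv
  obtain K where K: "compact K" "\<And>x. x \<notin> K \<Longrightarrow> f x = 0"
    by (rule test_fun_support[OF f]) metis
  obtain K' where K': "compact K'" "\<And>x. x \<notin> K' \<Longrightarrow> g x = 0"
    by (rule test_fun_support[OF g]) metis
  have "(\<integral>x. dderiv v f x * g x + f x * dderiv v g x \<partial>lborel) = 0"
  proof (rule integral_derivative_eq_0[of "\<lambda>x. f x * g x" v _ "K \<union> K'"])
    show "((\<lambda>t. f (x + t *\<^sub>R v) * g (x + t *\<^sub>R v)) has_real_derivative
        dderiv v f (x + t *\<^sub>R v) * g (x + t *\<^sub>R v) + f (x + t *\<^sub>R v) * dderiv v g (x + t *\<^sub>R v)) (at t)" for x t
      using DERIV_mult[OF smooth_line_derivative[of f x v t UNIV] smooth_line_derivative[of g x v t UNIV]]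
      by (simp add: algebra_simps)
    show "continuous_on UNIV (\<lambda>x. f x * g x)"
      by (rule continuous_on_mult) (simp_all add: smooth_continuous)
    show "continuous_on UNIV (\<lambda>x. dderiv v f x * g x + f x * dderiv v g x)"
      by (rule continuous_on_add; rule continuous_on_mult) (simp_all add: smooth_continuous)
  qed (simp_all add: compact_Un K K')
  moreover have "integrable lborel (\<lambda>x. dderiv v f x * g x)" "integrable lborel (\<lambda>x. f x * dderiv v g x)"
    by (intro test_fun_integrable_mult test_fun_dderiv f g)+
  ultimately show ?thesis by simp
qed

subsection \<open>The polyharmonic form as a sum of squares\<close>

text \<open>Unfolded: the sum over all m-tuples of basis vectors of the integral of the
  corresponding m-fold derivative of f times that of g. On test functions it is <(-\<Delta>)^m f, g>
  with the derivatives shared equally, which makes symmetry and positivity visible.\<close>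

fun Eform :: "nat \<Rightarrow> ('a::euclidean_space \<Rightarrow> real) \<Rightarrow> ('a \<Rightarrow> real) \<Rightarrow> real" where
  "Eform 0 f g = (\<integral>x. f x * g x \<partial>lborel)"
| "Eform (Suc m) f g = (\<Sum>b\<in>Basis. Eform m (dderiv b f) (dderiv b g))"

lemma Eform_commute: "Eform m f g = Eform m g f"
  by (induction m arbitrary: f g) (auto simp: mult.commute intro!: sum.cong)

lemma Eform_nonneg: "0 \<le> Eform m f f"
  by (induction m arbitrary: f) (auto intro!: sum_nonneg)

lemma Eform_lincomb:
  assumes "test_fun UNIV f" "test_fun UNIV g" "test_fun UNIV h"
  shows "Eform m (\<lambda>x. a * f x + b * g x) h = a * Eform m f h + b * Eform m g h"
  using assms
proof (induction m arbitrary: f g h)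
  case 0
  then show ?case
    using test_fun_integrable_mult[OF 0(1,3)] test_fun_integrable_mult[OF 0(2,3)]
    by (simp add: ring_distribs mult.assoc)
next
  case (Suc m)
  then show ?case
    by (simp add: dderiv_lincomb test_funD test_fun_dderiv sum.distrib sum_distrib_left)
qed

text \<open>The coordinate derivatives commute with the one along v, so the integration by parts
  takes place at the bottom of the recursion.\<close>

lemma Eform_dderiv:
  assumes "test_fun UNIV f" "test_fun UNIV g"
  shows "Eform m (dderiv v f) g = - Eform m f (dderiv v g)"
  using assms
proof (induction m arbitrary: f g)
  case 0
  then show ?case by (simp add: integration_by_parts)
next
  case (Suc m)
  have "Eform m (dderiv b (dderiv v f)) (dderiv b g) = - Eform m (dderiv b f) (dderiv b (dderiv v g))" for b
    using Suc.IH[of "dderiv b f" "dderiv b g"] Suc.prems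
    by (simp add: dderiv_commute[of _ b v] test_funD test_fun_dderiv)
  then show ?case by (simp add: sum_negf)
qed

lemma test_fun_sum:
  assumes "finite B" "\<And>b. b \<in> B \<Longrightarrow> test_fun \<Omega> (u b)"
  shows "test_fun \<Omega> (\<lambda>x. \<Sum>b\<in>B. c b * u b x)"
  using assms
proof (induction B rule: finite_induct)
  case empty
  then show ?case by (simp add: test_fun_zero)
next
  case (insert b B)
  then show ?case
    using test_fun_lincomb[of \<Omega> "u b" "\<lambda>x. \<Sum>b\<in>B. c b * u b x" "c b" 1] by simp
qed

lemma dderiv_zero: "dderiv v (\<lambda>x. 0) = (\<lambda>x. 0)"
  by (simp add: dderiv_def)

lemma dderiv_sum:
  assumes "finite B" "\<And>b. b \<in> B \<Longrightarrow> test_fun \<Omega> (u b)"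
  shows "dderiv v (\<lambda>x. \<Sum>b\<in>B. c b * u b x) = (\<lambda>x. \<Sum>b\<in>B. c b * dderiv v (u b) x)"
  using assms
proof (induction B rule: finite_induct)
  case empty
  then show ?case by (simp add: dderiv_zero)
next
  case (insert b B)
  then show ?case
    using dderiv_lincomb[of "u b" "\<lambda>x. \<Sum>b\<in>B. c b * u b x" v "c b" 1]
      test_funD[OF test_fun_sum[OF insert(1), of \<Omega> u c]] test_funD[of \<Omega> "u b"] by simp
qed

lemma Eform_sum:
  assumes "finite B" "\<And>b. b \<in> B \<Longrightarrow> test_fun UNIV (u b)" "test_fun UNIV h"
  shows "Eform m (\<lambda>x. \<Sum>b\<in>B. c b * u b x) h = (\<Sum>b\<in>B. c b * Eform m (u b) h)"
  using assms
proof (induction B rule: finite_induct)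
  case empty
  then show ?case
    using Eform_lincomb[OF test_fun_zero test_fun_zero, of h m 0 0] by simp
next
  case (insert b B)
  then show ?case
    using Eform_lincomb[of "u b" "\<lambda>x. \<Sum>b\<in>B. c b * u b x" h m "c b" 1] test_fun_sum[OF insert(1), of UNIV u c]
    by simp
qed

lemma neg_laplacian_eq: "(\<lambda>x. - laplacian f x) = (\<lambda>x. \<Sum>b\<in>Basis. (-1) * dderiv b (dderiv b f) x)"
  by (simp add: laplacian_def dderiv_def sum_negf)

lemma test_fun_neg_laplacian: "test_fun \<Omega> f \<Longrightarrow> test_fun \<Omega> (\<lambda>x. - laplacian f x)"
  unfolding neg_laplacian_eq by (intro test_fun_sum test_fun_dderiv) auto

lemma test_fun_polylap: "test_fun \<Omega> f \<Longrightarrow> test_fun \<Omega> (polylap m f)"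
  unfolding polylap_def by (induction m) (auto intro: test_fun_neg_laplacian)

text \<open>One factor -\<Delta> is split off next to f, and each of its second derivatives passes
  one derivative to g; the sign produced cancels that of -\<Delta>.\<close>

lemma integral_polylap:
  assumes "test_fun UNIV f" "test_fun UNIV g"
  shows "(\<integral>x. polylap m f x * g x \<partial>lborel) = Eform m f g"
  using assms
proof (induction m arbitrary: f)
  case 0
  then show ?case by (simp add: polylap_def)
next
  case (Suc m)
  have "(\<integral>x. polylap (Suc m) f x * g x \<partial>lborel) = (\<integral>x. polylap m (\<lambda>x. - laplacian f x) x * g x \<partial>lborel)"
    by (simp only: polylap_def funpow_Suc_right o_apply)
  also have "\<dots> = Eform m (\<lambda>x. - laplacian f x) g"
    using Suc by (simp add: test_fun_neg_laplacian)
  also have "\<dots> = (\<Sum>b\<in>Basis. (-1) * Eform m (dderiv b (dderiv b f)) g)"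
    unfolding neg_laplacian_eq using Suc.prems by (intro Eform_sum test_fun_dderiv) auto
  also have "\<dots> = Eform (Suc m) f g"
    using Suc.prems by (simp add: Eform_dderiv test_fun_dderiv)
  finally show ?case .
qed

text \<open>Stated for a family \<open>u b\<close> rather than for the gradient of one function, so
  that the induction can differentiate the whole family. At m = 0 it is the pointwise Cauchy-Schwarz
  inequality in the index b.\<close>

lemma Eform_directional_le:
  fixes u :: "'a::euclidean_space \<Rightarrow> 'a \<Rightarrow> real"
  assumes "norm \<omega> \<le> 1" "\<And>b. b \<in> Basis \<Longrightarrow> test_fun UNIV (u b)"
  shows "Eform m (\<lambda>x. \<Sum>b\<in>Basis. (\<omega> \<bullet> b) * u b x) (\<lambda>x. \<Sum>b\<in>Basis. (\<omega> \<bullet> b) * u b x)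
    \<le> (\<Sum>b\<in>Basis. Eform m (u b) (u b))"
  using assms(2)
proof (induction m arbitrary: u)
  case 0
  have "(\<Sum>b\<in>Basis. (\<omega> \<bullet> b) * u b x) * (\<Sum>b\<in>Basis. (\<omega> \<bullet> b) * u b x) \<le> (\<Sum>b\<in>Basis. u b x * u b x)" for x
  proof -
    have "(\<Sum>b\<in>Basis. (\<omega> \<bullet> b) * u b x)\<^sup>2 \<le> (\<Sum>b\<in>Basis. (\<omega> \<bullet> b)\<^sup>2) * (\<Sum>b\<in>Basis. (u b x)\<^sup>2)"
      by (rule Cauchy_Schwarz_ineq_sum)
    also have "(\<Sum>b\<in>Basis. (\<omega> \<bullet> b)\<^sup>2) = (norm \<omega>)\<^sup>2"
      by (subst power2_norm_eq_inner, subst euclidean_inner) (simp add: power2_eq_square)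
    also have "(norm \<omega>)\<^sup>2 * (\<Sum>b\<in>Basis. (u b x)\<^sup>2) \<le> 1 * (\<Sum>b\<in>Basis. (u b x)\<^sup>2)"
      using assms(1) by (intro mult_right_mono sum_nonneg) (auto simp: power_le_one)
    finally show ?thesis by (simp add: power2_eq_square)
  qed
  then have "(\<integral>x. (\<Sum>b\<in>Basis. (\<omega> \<bullet> b) * u b x) * (\<Sum>b\<in>Basis. (\<omega> \<bullet> b) * u b x) \<partial>lborel)
      \<le> (\<integral>x. (\<Sum>b\<in>Basis. u b x * u b x) \<partial>lborel)"
    using 0 by (intro integral_mono Bochner_Integration.integrable_sum test_fun_integrable_mult test_fun_sum) auto
  also have "\<dots> = (\<Sum>b\<in>Basis. \<integral>x. u b x * u b x \<partial>lborel)"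
    using 0 by (intro Bochner_Integration.integral_sum test_fun_integrable_mult) auto
  finally show ?case by simp
next
  case (Suc m)
  have "Eform (Suc m) (\<lambda>x. \<Sum>b\<in>Basis. (\<omega> \<bullet> b) * u b x) (\<lambda>x. \<Sum>b\<in>Basis. (\<omega> \<bullet> b) * u b x)
      = (\<Sum>c\<in>Basis. Eform m (\<lambda>x. \<Sum>b\<in>Basis. (\<omega> \<bullet> b) * dderiv c (u b) x) (\<lambda>x. \<Sum>b\<in>Basis. (\<omega> \<bullet> b) * dderiv c (u b) x))"
    using dderiv_sum[OF finite_Basis, of UNIV u] Suc.prems by simp
  also have "\<dots> \<le> (\<Sum>c\<in>Basis. \<Sum>b\<in>Basis. Eform m (dderiv c (u b)) (dderiv c (u b)))"
    using Suc.prems by (intro sum_mono Suc.IH test_fun_dderiv)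
  also have "\<dots> = (\<Sum>b\<in>Basis. Eform (Suc m) (u b) (u b))"
    by (subst sum.swap) simp
  finally show ?case .
qed

lemma dderiv_eq_sum:
  fixes f :: "'a::euclidean_space \<Rightarrow> real"
  assumes "smooth f"
  shows "dderiv \<omega> f = (\<lambda>x. \<Sum>b\<in>Basis. (\<omega> \<bullet> b) * dderiv b f x)"
proof
  fix x
  have lin: "linear (\<lambda>v. dderiv v f x)"
    using has_derivative_linear[OF smooth_has_derivative[OF assms]] .
  have "dderiv \<omega> f x = dderiv (\<Sum>b\<in>Basis. (\<omega> \<bullet> b) *\<^sub>R b) f x"
    by (simp add: euclidean_representation)
  then show "dderiv \<omega> f x = (\<Sum>b\<in>Basis. (\<omega> \<bullet> b) * dderiv b f x)"
    by (simp add: linear_sum[OF lin] linear_scale[OF lin])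
qed

text \<open>Each step expands one derivative along \<omega> in coordinates and trades it for the sum
  over all coordinate derivatives. On the Fourier side this is the comparison of |\<omega> \<bullet>
  \<xi>| with the norm of \<xi>.\<close>

lemma integral_dderiv_power_le_Eform:
  fixes f :: "'a::euclidean_space \<Rightarrow> real"
  assumes "norm \<omega> \<le> 1" "test_fun UNIV f"
  shows "(\<integral>x. ((dderiv \<omega> ^^ m) f x)\<^sup>2 \<partial>lborel) \<le> Eform m f f"
  using assms(2)
proof (induction m arbitrary: f)
  case 0
  then show ?case by (simp add: power2_eq_square)
next
  case (Suc m)
  have "(\<integral>x. ((dderiv \<omega> ^^ Suc m) f x)\<^sup>2 \<partial>lborel) \<le> Eform m (dderiv \<omega> f) (dderiv \<omega> f)"
    using Suc by (simp add: funpow_Suc_right test_fun_dderiv del: funpow.simps)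
  also have "\<dots> \<le> Eform (Suc m) f f"
    unfolding dderiv_eq_sum[OF test_funD[OF Suc.prems], of \<omega>] Eform.simps
    by (intro Eform_directional_le assms test_fun_dderiv Suc.prems)
  finally show ?case .
qed

subsection \<open>A Poincare inequality from directional distances\<close>

text \<open>For open \<Omega> these are the pairs whose directional distance is at most L. A witness
  with a non-strict bound, jointly in (x, \<omega>), makes the set closed, so that it and its
  sections are measurable.\<close>

definition near_exit :: "'a::euclidean_space set \<Rightarrow> real \<Rightarrow> ('a \<times> 'a) set" where
  "near_exit \<Omega> L = {(x, \<omega>). \<exists>s. \<bar>s\<bar> \<le> L \<and> x + s *\<^sub>R \<omega> \<notin> \<Omega>}"

text \<open>Exit parameters stay in the compact interval [-L, L], and a limit of points outside
  \<Omega> stays outside because \<Omega> is open.\<close>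

lemma closed_near_exit:
  fixes \<Omega> :: "'a::euclidean_space set"
  assumes "open \<Omega>"
  shows "closed (near_exit \<Omega> L)"
  unfolding closed_sequential_limits
proof (intro allI impI, elim conjE)
  fix z and l :: "'a \<times> 'a"
  assume "\<forall>n. z n \<in> near_exit \<Omega> L" and lim: "z \<longlonglongrightarrow> l"
  then have "\<forall>n. \<exists>s. \<bar>s\<bar> \<le> L \<and> fst (z n) + s *\<^sub>R snd (z n) \<notin> \<Omega>"
    by (auto simp: near_exit_def split_def)
  then obtain s where s: "\<And>n. \<bar>s n\<bar> \<le> L" "\<And>n. fst (z n) + s n *\<^sub>R snd (z n) \<notin> \<Omega>"
    by metis
  have "\<forall>n. s n \<in> {-L..L}" using s(1) by (auto simp: abs_le_iff minus_le_iff)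
  then obtain t r where t: "t \<in> {-L..L}" "strict_mono r" "(s \<circ> r) \<longlonglongrightarrow> t"
    using seq_compactE[OF compact_imp_seq_compact[OF compact_Icc]] by metis
  have lim': "(\<lambda>n. fst ((z \<circ> r) n) + (s \<circ> r) n *\<^sub>R snd ((z \<circ> r) n)) \<longlonglongrightarrow> fst l + t *\<^sub>R snd l"
    by (intro tendsto_intros t LIMSEQ_subseq_LIMSEQ lim)
  have "fst l + t *\<^sub>R snd l \<in> - \<Omega>"
    by (rule closed_sequentially[OF _ _ lim']) (use s(2) assms in \<open>auto simp: closed_Compl\<close>)
  moreover have "\<bar>t\<bar> \<le> L" using t(1) by auto
  ultimately show "l \<in> near_exit \<Omega> L"
    unfolding near_exit_def split_def by blast
qed

text \<open>Up to sign, g x is the integral of its derivative up to the zero at parameter s;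
  Cauchy-Schwarz on an interval of length |s| <= L gives the square. The endpoints min 0 s and max 0
  s cover both signs of s.\<close>

lemma square_le_line_integral:
  fixes g :: "'a::euclidean_space \<Rightarrow> real"
  assumes g: "smooth g" and s: "\<bar>s\<bar> \<le> L" "g (x + s *\<^sub>R \<omega>) = 0"
  shows "ennreal ((g x)\<^sup>2) \<le> ennreal L * (\<integral>\<^sup>+t. indicator {min 0 s..max 0 s} t * ennreal ((dderiv \<omega> g (x + t *\<^sub>R \<omega>))\<^sup>2) \<partial>lborel)"
proof -
  define u where "u t = g (x + t *\<^sub>R \<omega>)" for t
  define u' where "u' t = dderiv \<omega> g (x + t *\<^sub>R \<omega>)" for t
  define a b where "a = min 0 s" and "b = max 0 s"
  have ab: "a \<le> b" "b - a = \<bar>s\<bar>" by (auto simp: a_def b_def)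
  have der: "(u has_real_derivative u' t) (at t within S)" for t S
    unfolding u_def u'_def by (rule smooth_line_derivative[OF g])
  have cont: "continuous_on S u'" for S
    unfolding u'_def
    using continuous_on_compose2[OF smooth_continuous[OF smooth_dderiv[OF g, of \<omega>], of UNIV], of S "\<lambda>t. x + t *\<^sub>R \<omega>"]
    by (simp add: continuous_on_add continuous_on_scaleR)
  have [measurable]: "u' \<in> borel_measurable borel"
    using cont by (rule borel_measurable_continuous_onI)
  have bint: "has_bochner_integral lborel (\<lambda>t. indicator {a..b} t *\<^sub>R u' t) (u b - u a)"
    using der by (intro has_bochner_integral_FTC_Icc[OF ab(1)] cont)
      (auto simp: has_real_derivative_iff_has_vector_derivative)
  have "\<bar>g x\<bar> = norm (u b - u a)"
    using s(2) by (auto simp: u_def a_def b_def min_def max_def)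
  also have "ennreal \<dots> \<le> (\<integral>\<^sup>+t. norm (indicator {a..b} t *\<^sub>R u' t) \<partial>lborel)"
    using integral_norm_bound_ennreal[of lborel "\<lambda>t. indicator {a..b} t *\<^sub>R u' t"] bint
    by (simp add: has_bochner_integral_iff)
  also have "\<dots> = (\<integral>\<^sup>+t. indicator {a..b} t * (indicator {a..b} t * ennreal \<bar>u' t\<bar>) \<partial>lborel)"
    by (intro nn_integral_cong) (auto simp: indicator_def)
  finally have "(ennreal \<bar>g x\<bar>)\<^sup>2 \<le> (\<integral>\<^sup>+t. indicator {a..b} t * (indicator {a..b} t * ennreal \<bar>u' t\<bar>) \<partial>lborel)\<^sup>2"
    by (rule power_mono) simp
  also have "\<dots> \<le> (\<integral>\<^sup>+t. (indicator {a..b} t)\<^sup>2 \<partial>lborel) * (\<integral>\<^sup>+t. (indicator {a..b} t * ennreal \<bar>u' t\<bar>)\<^sup>2 \<partial>lborel)"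
    by (rule Cauchy_Schwarz_nn_integral) measurable
  also have "(\<integral>\<^sup>+t. (indicator {a..b} t)\<^sup>2 \<partial>lborel) = (\<integral>\<^sup>+t. indicator {a..b} t \<partial>lborel)"
    by (intro nn_integral_cong) (auto simp: indicator_def)
  also have "\<dots> = ennreal \<bar>s\<bar>"
    using ab by simp
  also have "(\<integral>\<^sup>+t. (indicator {a..b} t * ennreal \<bar>u' t\<bar>)\<^sup>2 \<partial>lborel) = (\<integral>\<^sup>+t. indicator {a..b} t * ennreal ((u' t)\<^sup>2) \<partial>lborel)"
    by (intro nn_integral_cong) (auto simp: indicator_def ennreal_power)
  also have "ennreal \<bar>s\<bar> * \<dots> \<le> ennreal L * \<dots>"
    using s(1) by (intro mult_right_mono ennreal_leI) auto
  finally show ?thesis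
    by (simp add: ennreal_power a_def b_def u'_def)
qed

text \<open>One factor L comes from Cauchy-Schwarz on the segment, the factor 2 L from the length of
  [-L, L] after Tonelli and translation invariance. Keeping the indicator of E on the right is what
  allows iteration.\<close>

lemma directional_poincare_step:
  fixes g :: "'a::euclidean_space \<Rightarrow> real" and \<omega> :: 'a
  assumes "open \<Omega>" "0 \<le> L" and g: "test_fun \<Omega> g"
  defines "E \<equiv> {x. (x, \<omega>) \<in> near_exit \<Omega> L}"
  shows "(\<integral>\<^sup>+x. indicator E x * ennreal ((g x)\<^sup>2) \<partial>lborel)
    \<le> ennreal (2 * L\<^sup>2) * (\<integral>\<^sup>+x. indicator E x * ennreal ((dderiv \<omega> g x)\<^sup>2) \<partial>lborel)"
proof -
  have "closed ((\<lambda>x. (x, \<omega>)) -` near_exit \<Omega> L)"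
    by (intro closed_vimage closed_near_exit assms continuous_intros)
  then have [measurable]: "E \<in> sets borel"
    by (simp add: E_def vimage_def)
  have [measurable]: "g \<in> borel_measurable borel" "dderiv \<omega> g \<in> borel_measurable borel"
    by (intro borel_measurable_continuous_onI smooth_continuous smooth_dderiv test_funD[OF g])+
  define H where "H x = indicator E x * ennreal ((dderiv \<omega> g x)\<^sup>2)" for x
  have H [measurable]: "H \<in> borel_measurable borel"
    unfolding H_def by measurable
  have pw: "indicator E x * ennreal ((g x)\<^sup>2) \<le> ennreal L * (\<integral>\<^sup>+t. indicator {-L..L} t * H (t *\<^sub>R \<omega> + x) \<partial>lborel)" for x
  proof (cases "x \<in> E")
    case True
    then obtain s where s: "\<bar>s\<bar> \<le> L" "x + s *\<^sub>R \<omega> \<notin> \<Omega>"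
      by (auto simp: E_def near_exit_def)
    have "ennreal ((g x)\<^sup>2) \<le> ennreal L * (\<integral>\<^sup>+t. indicator {min 0 s..max 0 s} t * ennreal ((dderiv \<omega> g (x + t *\<^sub>R \<omega>))\<^sup>2) \<partial>lborel)"
      by (intro square_le_line_integral test_funD[OF g] s test_fun_eq_0[OF g])
    also have "\<dots> \<le> ennreal L * (\<integral>\<^sup>+t. indicator {-L..L} t * H (t *\<^sub>R \<omega> + x) \<partial>lborel)"
    proof (intro mult_left_mono nn_integral_mono)
      fix t
      show "indicator {min 0 s..max 0 s} t * ennreal ((dderiv \<omega> g (x + t *\<^sub>R \<omega>))\<^sup>2)
          \<le> indicator {-L..L} t * H (t *\<^sub>R \<omega> + x)"
      proof (cases "t \<in> {min 0 s..max 0 s}")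
        case True
        \<comment> \<open>The shifted point leaves \<Omega> at the same place, with parameter s - t,
          so it lies in E again.\<close>
        then have "\<bar>s - t\<bar> \<le> L" "t \<in> {-L..L}" using s(1) by auto
        moreover have "x + t *\<^sub>R \<omega> + (s - t) *\<^sub>R \<omega> = x + s *\<^sub>R \<omega>"
          by (simp add: algebra_simps)
        then have "\<bar>s - t\<bar> \<le> L \<Longrightarrow> x + t *\<^sub>R \<omega> \<in> E"
          using s(2) unfolding E_def near_exit_def mem_Collect_eq split_conv by metis
        ultimately show ?thesis
          using True by (simp add: H_def add.commute indicator_def)
      qed simp
    qed simp
    finally show ?thesis using True by simp
  qed simp
  have "(\<integral>\<^sup>+x. indicator E x * ennreal ((g x)\<^sup>2) \<partial>lborel)
      \<le> (\<integral>\<^sup>+x. ennreal L * (\<integral>\<^sup>+t. indicator {-L..L} t * H (t *\<^sub>R \<omega> + x) \<partial>lborel) \<partial>lborel)"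
    by (intro nn_integral_mono pw)
  also have "\<dots> = ennreal L * (\<integral>\<^sup>+x. \<integral>\<^sup>+t. indicator {-L..L} t * H (t *\<^sub>R \<omega> + x) \<partial>lborel \<partial>lborel)"
    by (intro nn_integral_cmult) measurable
  also have "(\<integral>\<^sup>+x. \<integral>\<^sup>+t. indicator {-L..L} t * H (t *\<^sub>R \<omega> + x) \<partial>lborel \<partial>lborel)
      = (\<integral>\<^sup>+t. \<integral>\<^sup>+x. indicator {-L..L} t * H (t *\<^sub>R \<omega> + x) \<partial>lborel \<partial>lborel)"
    by (rule lborel_pair.Fubini') measurable
  also have "\<dots> = (\<integral>\<^sup>+t. indicator {-L..L} t * (\<integral>\<^sup>+x. H x \<partial>lborel) \<partial>lborel)"
  proof (intro nn_integral_cong)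
    fix t
    have "(\<integral>\<^sup>+x. indicator {-L..L} t * H (t *\<^sub>R \<omega> + x) \<partial>lborel)
        = indicator {-L..L} t * (\<integral>\<^sup>+x. H (t *\<^sub>R \<omega> + x) \<partial>lborel)"
      by (rule nn_integral_cmult) measurable
    then show "(\<integral>\<^sup>+x. indicator {-L..L} t * H (t *\<^sub>R \<omega> + x) \<partial>lborel) = indicator {-L..L} t * (\<integral>\<^sup>+x. H x \<partial>lborel)"
      by (simp add: lborel_nn_integral_translate[OF H])
  qed
  also have "\<dots> = ennreal (2 * L) * (\<integral>\<^sup>+x. H x \<partial>lborel)"
    using assms(2) by (subst nn_integral_multc) (simp_all flip: mult_2)
  also have "ennreal L * \<dots> = ennreal (2 * L\<^sup>2) * (\<integral>\<^sup>+x. H x \<partial>lborel)"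
    using assms(2) by (simp add: power2_eq_square mult.left_commute[of 2] ennreal_mult mult.assoc)
  finally show ?thesis
    by (simp add: H_def)
qed

text \<open>Every iterated derivative along \<omega> is again a test function on \<Omega>, so one
  and the same E works m times; only the last integral is enlarged to the whole space.\<close>

lemma directional_poincare:
  fixes f :: "'a::euclidean_space \<Rightarrow> real"
  assumes "open \<Omega>" "0 \<le> L" "norm \<omega> \<le> 1" "test_fun \<Omega> f"
  shows "(\<integral>\<^sup>+x. indicator (near_exit \<Omega> L) (x, \<omega>) * ennreal ((f x)\<^sup>2) \<partial>lborel)
    \<le> ennreal ((2 * L\<^sup>2) ^ m * Eform m f f)"
proof -
  define E where "E = {x. (x, \<omega>) \<in> near_exit \<Omega> L}"
  have ind: "indicator (near_exit \<Omega> L) (x, \<omega>) = (indicator E x :: ennreal)" for x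
    by (simp add: E_def indicator_def)
  have iter: "(\<integral>\<^sup>+x. indicator E x * ennreal ((f x)\<^sup>2) \<partial>lborel)
      \<le> ennreal ((2 * L\<^sup>2) ^ m) * (\<integral>\<^sup>+x. indicator E x * ennreal (((dderiv \<omega> ^^ m) f x)\<^sup>2) \<partial>lborel)"
    using assms(4)
  proof (induction m arbitrary: f)
    case 0
    then show ?case by simp
  next
    case (Suc m)
    have "(\<integral>\<^sup>+x. indicator E x * ennreal ((f x)\<^sup>2) \<partial>lborel)
        \<le> ennreal (2 * L\<^sup>2) * (\<integral>\<^sup>+x. indicator E x * ennreal ((dderiv \<omega> f x)\<^sup>2) \<partial>lborel)"
      unfolding E_def by (rule directional_poincare_step[OF assms(1,2) Suc.prems])
    also have "\<dots> \<le> ennreal (2 * L\<^sup>2) * (ennreal ((2 * L\<^sup>2) ^ m) *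
        (\<integral>\<^sup>+x. indicator E x * ennreal (((dderiv \<omega> ^^ m) (dderiv \<omega> f) x)\<^sup>2) \<partial>lborel))"
      by (intro mult_left_mono Suc.IH test_fun_dderiv Suc.prems) simp
    finally show ?case
      by (simp add: funpow_Suc_right ennreal_mult mult.assoc del: funpow.simps)
  qed
  have f: "test_fun UNIV f" using test_fun_mono[OF assms(4)] by simp
  have "test_fun UNIV ((dderiv \<omega> ^^ m) f)"
    by (induction m) (auto intro: f test_fun_dderiv)
  from test_fun_integrable_mult[OF this this]
  have int: "integrable lborel (\<lambda>x. ((dderiv \<omega> ^^ m) f x)\<^sup>2)"
    by (simp add: power2_eq_square)
  have "(\<integral>\<^sup>+x. indicator E x * ennreal (((dderiv \<omega> ^^ m) f x)\<^sup>2) \<partial>lborel)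
      \<le> (\<integral>\<^sup>+x. ennreal (((dderiv \<omega> ^^ m) f x)\<^sup>2) \<partial>lborel)"
    by (intro nn_integral_mono) (auto simp: indicator_def)
  also have "\<dots> = ennreal (\<integral>x. ((dderiv \<omega> ^^ m) f x)\<^sup>2 \<partial>lborel)"
    by (rule nn_integral_eq_integral[OF int]) simp
  also have "\<dots> \<le> ennreal (Eform m f f)"
    by (intro ennreal_leI integral_dderiv_power_le_Eform assms f)
  finally have "ennreal ((2 * L\<^sup>2) ^ m) * (\<integral>\<^sup>+x. indicator E x * ennreal (((dderiv \<omega> ^^ m) f x)\<^sup>2) \<partial>lborel)
      \<le> ennreal ((2 * L\<^sup>2) ^ m) * ennreal (Eform m f f)"
    by (rule mult_left_mono) simp
  with iter show ?thesis
    unfolding ind by (simp add: ennreal_mult' Eform_nonneg)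
qed

section \<open>Averaging over the sphere of directions\<close>

lemma sets_sphere_measure [simp, measurable_cong]: "sets sphere_measure = sets borel"
  by (simp add: sphere_measure_def)

lemma space_sphere_measure [simp]: "space sphere_measure = UNIV"
  by (simp add: sphere_measure_def)

lemma measurable_sgn_uniform [measurable]:
  "sgn \<in> borel_measurable (uniform_measure lborel (ball 0 1 :: 'a::euclidean_space set))"
  unfolding sgn_div_norm by measurable

lemma emeasure_sphere_measure_UNIV:
  "emeasure (sphere_measure :: 'a::euclidean_space measure) UNIV = 1"
proof -
  have "emeasure lborel (ball (0::'a) 1) \<noteq> 0" "emeasure lborel (ball (0::'a) 1) \<noteq> \<infinity>"
    using emeasure_lborel_ball_finite[of "0::'a" 1] content_ball_pos[of 1 "0::'a"]
    by (auto simp: measure_def less_top[symmetric])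
  then show ?thesis
    using emeasure_uniform_measure_1[of lborel "ball (0::'a) 1"]
    unfolding sphere_measure_def by (subst emeasure_distr) auto
qed

text \<open>\<open>sgn\<close> takes the value 0 at 0, so the bound by 1 holds everywhere; it is
  what the directional estimates ask for.\<close>

lemma AE_sphere_measure_norm_le_1: "AE \<omega> in sphere_measure. norm \<omega> \<le> 1"
  unfolding sphere_measure_def by (subst AE_distr_iff) (auto simp: norm_sgn)

text \<open>At each point of \<Omega> the directions with a near exit have mass at least \<sigma>.
  Tonelli exchanges points and directions, and the directional bound is the same for all
  \<omega>.\<close>

lemma poincare_of_near_exit:
  fixes f :: "'a::euclidean_space \<Rightarrow> real"
  assumes "open \<Omega>" "0 \<le> L" "test_fun \<Omega> f"
    and \<sigma>: "\<And>x. x \<in> \<Omega> \<Longrightarrow> ennreal \<sigma> \<le> emeasure sphere_measure {\<omega>. (x, \<omega>) \<in> near_exit \<Omega> L}"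
  shows "\<sigma> * (\<integral>x. (f x)\<^sup>2 \<partial>lborel) \<le> (2 * L\<^sup>2) ^ m * Eform m f f"
proof (cases "\<sigma> \<le> 0")
  \<comment> \<open>\<open>ennreal\<close> sends negative numbers to 0, so this case is separated;
    here the claim holds by sign.\<close>
  case True
  then have "\<sigma> * (\<integral>x. (f x)\<^sup>2 \<partial>lborel) \<le> 0"
    by (simp add: mult_nonpos_nonneg)
  also have "0 \<le> (2 * L\<^sup>2) ^ m * Eform m f f"
    by (simp add: Eform_nonneg)
  finally show ?thesis .
next
  case False
  interpret S: finite_measure "sphere_measure :: 'a measure"
    by (rule finite_measureI) (simp add: emeasure_sphere_measure_UNIV)
  interpret P: pair_sigma_finite "lborel :: 'a measure" "sphere_measure :: 'a measure" ..
  have [measurable]: "near_exit \<Omega> L \<in> sets (borel \<Otimes>\<^sub>M borel)"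
    unfolding borel_prod by (intro borel_closed closed_near_exit assms)
  have f: "test_fun UNIV f" using test_fun_mono[OF assms(3)] by simp
  have [measurable]: "f \<in> borel_measurable borel"
    by (intro borel_measurable_continuous_onI smooth_continuous test_funD[OF f])
  have int: "integrable lborel (\<lambda>x. (f x)\<^sup>2)"
    using test_fun_integrable_mult[OF f f] by (simp add: power2_eq_square)
  have sec: "{\<omega>. (x, \<omega>) \<in> near_exit \<Omega> L} \<in> sets sphere_measure" for x
  proof -
    have "closed ((\<lambda>\<omega>. (x, \<omega>)) -` near_exit \<Omega> L)"
      by (intro closed_vimage closed_near_exit assms continuous_intros)
    then show ?thesis by (simp add: vimage_def)
  qed
  have "ennreal (\<sigma> * (\<integral>x. (f x)\<^sup>2 \<partial>lborel)) = ennreal \<sigma> * (\<integral>\<^sup>+x. ennreal ((f x)\<^sup>2) \<partial>lborel)"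
    using False by (subst nn_integral_eq_integral[OF int]) (simp_all add: ennreal_mult)
  also have "\<dots> = (\<integral>\<^sup>+x. ennreal \<sigma> * ennreal ((f x)\<^sup>2) \<partial>lborel)"
    by (rule nn_integral_cmult[symmetric]) measurable
  also have "\<dots> \<le> (\<integral>\<^sup>+x. \<integral>\<^sup>+\<omega>. indicator (near_exit \<Omega> L) (x, \<omega>) * ennreal ((f x)\<^sup>2) \<partial>sphere_measure \<partial>lborel)"
  proof (rule nn_integral_mono)
    fix x
    have "ennreal \<sigma> * ennreal ((f x)\<^sup>2) \<le> emeasure sphere_measure {\<omega>. (x, \<omega>) \<in> near_exit \<Omega> L} * ennreal ((f x)\<^sup>2)"
      using \<sigma>[of x] test_fun_eq_0[OF assms(3), of x] by (cases "x \<in> \<Omega>") (auto intro: mult_right_mono)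
    also have "\<dots> = (\<integral>\<^sup>+\<omega>. indicator {\<omega>. (x, \<omega>) \<in> near_exit \<Omega> L} \<omega> * ennreal ((f x)\<^sup>2) \<partial>sphere_measure)"
      using sec by (simp add: nn_integral_multc)
    also have "\<dots> = (\<integral>\<^sup>+\<omega>. indicator (near_exit \<Omega> L) (x, \<omega>) * ennreal ((f x)\<^sup>2) \<partial>sphere_measure)"
      by (intro nn_integral_cong) (simp add: indicator_def)
    finally show "ennreal \<sigma> * ennreal ((f x)\<^sup>2) \<le> \<dots>" .
  qed
  also have "\<dots> = (\<integral>\<^sup>+\<omega>. \<integral>\<^sup>+x. indicator (near_exit \<Omega> L) (x, \<omega>) * ennreal ((f x)\<^sup>2) \<partial>lborel \<partial>sphere_measure)"
    by (rule P.Fubini'[symmetric]) measurable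
  also have "\<dots> \<le> (\<integral>\<^sup>+\<omega>. ennreal ((2 * L\<^sup>2) ^ m * Eform m f f) \<partial>(sphere_measure :: 'a measure))"
    by (intro nn_integral_mono_AE eventually_mono[OF AE_sphere_measure_norm_le_1] directional_poincare assms)
  also have "\<dots> = ennreal ((2 * L\<^sup>2) ^ m * Eform m f f)"
    by (simp add: emeasure_sphere_measure_UNIV)
  finally show ?thesis
    by (subst (asm) ennreal_le_iff) (simp_all add: Eform_nonneg)
qed

section \<open>The share of directions with a near exit\<close>

lemma ennreal_inverse_antimono: "x \<le> y \<Longrightarrow> inverse y \<le> inverse (x :: ennreal)"
  including ennreal.lifting by transfer (rule ereal_inverse_antimono)

lemma dist_bdry_le_dist_dir:
  assumes "norm \<omega> \<le> 1"
  shows "dist_bdry \<Omega> x \<le> dist_dir \<Omega> \<omega> x"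
  unfolding dist_dir_def
proof (rule Inf_greatest, clarify)
  fix s assume s: "x + s *\<^sub>R \<omega> \<notin> \<Omega>"
  then have "dist_bdry \<Omega> x \<le> ennreal (dist x (x + s *\<^sub>R \<omega>))"
    unfolding dist_bdry_def by (intro Inf_lower) blast
  also have "\<dots> \<le> ennreal \<bar>s\<bar>"
    using assms by (intro ennreal_leI) (simp add: dist_norm mult_left_le)
  finally show "dist_bdry \<Omega> x \<le> ennreal \<bar>s\<bar>" .
qed

lemma dist_bdry_pos:
  assumes "open \<Omega>" "x \<in> \<Omega>"
  shows "0 < dist_bdry \<Omega> x"
proof -
  obtain e where e: "e > 0" "ball x e \<subseteq> \<Omega>"
    using assms openE by blast
  have "ennreal e \<le> dist_bdry \<Omega> x"
    unfolding dist_bdry_def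
  proof (rule Inf_greatest, clarify)
    fix y assume "y \<notin> \<Omega>"
    then show "ennreal e \<le> ennreal (dist x y)"
      using e(2) by (intro ennreal_leI) (auto simp: subset_iff not_less[symmetric])
  qed
  then show ?thesis using e(1) by (metis ennreal_less_zero_iff order_less_le_trans)
qed

text \<open>Directions along which \<open>\<Omega>\<close> is left only after distance \<open>2 k d(x)\<close> contribute at most
  \<open>(2 k d(x))\<^bsup>-2m\<^esup>\<close> to \<open>a\<^sub>m(x)\<^bsup>-2m\<^esup> \<ge> (k d(x))\<^bsup>-2m\<^esup>\<close>, so the others fill a fixed share of the sphere.\<close>
lemma near_exit_measure_ge:
  fixes \<Omega> :: "'a::euclidean_space set"
  assumes "open \<Omega>" "x \<in> \<Omega>" "m \<ge> 1" "k \<ge> 1"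
    and reg: "a_m \<Omega> m x \<le> ennreal k * dist_bdry \<Omega> x"
    and R: "dist_bdry \<Omega> x \<le> ennreal R"
  shows "ennreal (1 / (2 * k ^ (2 * m))) \<le> emeasure sphere_measure {\<omega>. (x, \<omega>) \<in> near_exit \<Omega> (2 * k * R)}"
proof -
  obtain d where d: "dist_bdry \<Omega> x = ennreal d" "d \<ge> 0"
    using R by (cases "dist_bdry \<Omega> x") (auto simp: top_unique)
  have "d > 0" using dist_bdry_pos[OF assms(1,2)] d by simp
  then have "d \<le> R" using R d by (simp add: ennreal_le_iff2)
  have "k > 0" using assms(4) by simp
  define E where "E = {\<omega>. (x, \<omega>) \<in> near_exit \<Omega> (2 * k * R)}"
  define I where "I = am_integral \<Omega> m x"
  define p where "p = measure (sphere_measure :: 'a measure) E"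
  interpret S: finite_measure "sphere_measure :: 'a measure"
    by (rule finite_measureI) (simp add: emeasure_sphere_measure_UNIV)
  have p: "emeasure sphere_measure E = ennreal p"
    by (simp add: p_def S.emeasure_eq_measure)
  have "closed ((\<lambda>\<omega>. (x, \<omega>)) -` near_exit \<Omega> (2 * k * R))"
    by (intro closed_vimage closed_near_exit assms continuous_intros)
  then have [measurable]: "E \<in> sets borel"
    by (simp add: E_def vimage_def)
  \<comment> \<open>\<open>a_m\<close> is defined by cases on I. The value 0 would make it infinite,
    against the bound by k d; the value \<infinity> satisfies the claim at once; otherwise the root
    is undone by the power 2m.\<close>
  have lower: "ennreal (1 / (k * d) ^ (2 * m)) \<le> I"
  proof -
    have am: "a_m \<Omega> m x \<le> ennreal (k * d)"
      using reg \<open>k > 0\<close> \<open>d > 0\<close> by (simp add: d ennreal_mult)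
    consider "I = 0" | "I = \<infinity>" | i where "I = ennreal i" "i > 0"
      by (cases I) (auto simp: less_le)
    then show ?thesis
    proof cases
      case 1
      then show ?thesis using am by (simp add: a_m_def I_def[symmetric] top_unique)
    next
      case 2
      then show ?thesis by simp
    next
      case 3
      then have "ennreal (i powr (- 1 / (2 * real m))) \<le> ennreal (k * d)"
        using am by (simp add: a_m_def I_def[symmetric])
      then have "i powr (- 1 / (2 * real m)) \<le> k * d"
        using \<open>k > 0\<close> \<open>d > 0\<close> by (simp add: ennreal_le_iff)
      then have "(i powr (- 1 / (2 * real m))) ^ (2 * m) \<le> (k * d) ^ (2 * m)"
        by (intro power_mono) auto
      also have "(i powr (- 1 / (2 * real m))) ^ (2 * m) = i powr (- 1)"
        using 3 assms(3) by (simp flip: powr_realpow add: powr_powr)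
      also have "i powr (- 1) = 1 / i"
        using 3 by (simp add: powr_minus_divide)
      finally have "1 / (k * d) ^ (2 * m) \<le> i"
        using 3 \<open>k > 0\<close> \<open>d > 0\<close> by (simp add: field_simps)
      then show ?thesis using 3 by (simp add: ennreal_leI)
    qed
  qed
  \<comment> \<open>The cut is at distance 2 k d. From there on the integrand is at most (2 k
    d)^(-2m). Below it the direction lies in E because d <= R, and the directional distance is still
    at least d.\<close>
  have pw: "inverse (dist_dir \<Omega> \<omega> x ^ (2 * m))
      \<le> ennreal (1 / d ^ (2 * m)) * indicator E \<omega> + ennreal (1 / (2 * k * d) ^ (2 * m))"
    if \<omega>: "norm \<omega> \<le> 1" for \<omega>
  proof -
    have inv: "inverse (dist_dir \<Omega> \<omega> x ^ (2 * m)) \<le> ennreal (1 / c ^ (2 * m))"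
      if "ennreal c \<le> dist_dir \<Omega> \<omega> x" "c > 0" for c
    proof -
      have "ennreal (c ^ (2 * m)) \<le> dist_dir \<Omega> \<omega> x ^ (2 * m)"
        using power_mono[OF that(1), of "2 * m"] that(2) by (simp add: ennreal_power)
      then have "inverse (dist_dir \<Omega> \<omega> x ^ (2 * m)) \<le> inverse (ennreal (c ^ (2 * m)))"
        by (rule ennreal_inverse_antimono)
      then show ?thesis
        using that(2) by (simp add: inverse_ennreal inverse_eq_divide)
    qed
    show ?thesis
    proof (cases "ennreal (2 * k * d) \<le> dist_dir \<Omega> \<omega> x")
      case True
      then have "inverse (dist_dir \<Omega> \<omega> x ^ (2 * m)) \<le> ennreal (1 / (2 * k * d) ^ (2 * m))"
        using \<open>k > 0\<close> \<open>d > 0\<close> by (intro inv) auto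
      then show ?thesis by (rule order_trans) simp
    next
      case False
      then obtain s where s: "x + s *\<^sub>R \<omega> \<notin> \<Omega>" "ennreal \<bar>s\<bar> < ennreal (2 * k * d)"
        unfolding dist_dir_def not_le Inf_less_iff by blast
      then have "\<bar>s\<bar> \<le> 2 * k * d" by (simp add: ennreal_less_iff)
      also have "\<dots> \<le> 2 * k * R" using \<open>d \<le> R\<close> \<open>k > 0\<close> by simp
      finally have "\<omega> \<in> E" using s by (auto simp: E_def near_exit_def)
      moreover have "inverse (dist_dir \<Omega> \<omega> x ^ (2 * m)) \<le> ennreal (1 / d ^ (2 * m))"
        using dist_bdry_le_dist_dir[OF \<omega>, of \<Omega> x] d \<open>d > 0\<close> by (intro inv) auto
      ultimately show ?thesis
        by (simp add: add_increasing2)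
    qed
  qed
  have "I \<le> (\<integral>\<^sup>+\<omega>. ennreal (1 / d ^ (2 * m)) * indicator E \<omega> + ennreal (1 / (2 * k * d) ^ (2 * m)) \<partial>sphere_measure)"
    unfolding I_def am_integral_def
    by (intro nn_integral_mono_AE eventually_mono[OF AE_sphere_measure_norm_le_1] pw)
  also have "\<dots> = ennreal (1 / d ^ (2 * m)) * ennreal p + ennreal (1 / (2 * k * d) ^ (2 * m))"
    by (subst nn_integral_add) (simp_all add: nn_integral_cmult emeasure_sphere_measure_UNIV p)
  also have "\<dots> = ennreal (p / d ^ (2 * m) + 1 / (2 * k * d) ^ (2 * m))"
    using \<open>k > 0\<close> \<open>d > 0\<close> by (simp add: p_def flip: ennreal_mult ennreal_plus)
  finally have "ennreal (1 / (k * d) ^ (2 * m)) \<le> ennreal (p / d ^ (2 * m) + 1 / (2 * k * d) ^ (2 * m))"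
    using lower by order
  then have "1 / (k * d) ^ (2 * m) \<le> p / d ^ (2 * m) + 1 / (2 * k * d) ^ (2 * m)"
    using \<open>k > 0\<close> \<open>d > 0\<close> by (subst (asm) ennreal_le_iff) (auto simp: p_def)
  \<comment> \<open>Multiplying by d^(2m) removes the scale: what is left depends on x only through
    p.\<close>
  then have "d ^ (2 * m) * (1 / (k * d) ^ (2 * m)) \<le> d ^ (2 * m) * (p / d ^ (2 * m) + 1 / (2 * k * d) ^ (2 * m))"
    using \<open>d > 0\<close> by (intro mult_left_mono) auto
  then have "1 / k ^ (2 * m) \<le> p + 1 / (2 * k) ^ (2 * m)"
    using \<open>d > 0\<close> by (simp add: power_mult_distrib distrib_left)
  \<comment> \<open>Cutting at 2 k d rather than k d gains 2^(2m) >= 2, by m >= 1, so at most half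
    of k^(-2m) is lost.\<close>
  moreover have "1 / (2 * k) ^ (2 * m) \<le> 1 / (2 * k ^ (2 * m))"
    using \<open>k > 0\<close> self_le_power[of "2::real" "2 * m"] assms(3)
    by (intro divide_left_mono) (auto simp: power_mult_distrib)
  moreover have "1 / k ^ (2 * m) = 1 / (2 * k ^ (2 * m)) + 1 / (2 * k ^ (2 * m))"
    by simp
  ultimately have "1 / (2 * k ^ (2 * m)) \<le> p" by linarith
  then show ?thesis
    unfolding E_def[symmetric] p by (rule ennreal_leI)
qed

lemma poincare_of_regular:
  fixes \<Omega> :: "'a::euclidean_space set"
  assumes "open \<Omega>" "m \<ge> 1" "m_regular \<Omega> m" "finite_inradius \<Omega>"
  shows "\<exists>c>0. \<forall>f. test_fun \<Omega> f \<longrightarrow> c * (\<integral>x. (f x)\<^sup>2 \<partial>lborel) \<le> Eform m f f"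
proof -
  obtain k0 where k0: "\<And>x. x \<in> \<Omega> \<Longrightarrow> a_m \<Omega> m x \<le> ennreal k0 * dist_bdry \<Omega> x"
    using assms(3) unfolding m_regular_def by blast
  \<comment> \<open>Both constants are enlarged to at least 1: the upper bounds persist, and
    \<sigma> and L become positive.\<close>
  define k where "k = max 1 k0"
  have k: "a_m \<Omega> m x \<le> ennreal k * dist_bdry \<Omega> x" if "x \<in> \<Omega>" for x
    using k0[OF that] by (rule order_trans) (intro mult_right_mono ennreal_leI, auto simp: k_def)
  obtain R0 where R0: "(SUP x\<in>\<Omega>. dist_bdry \<Omega> x) = ennreal R0"
    using assms(4) unfolding finite_inradius_def by (cases "SUP x\<in>\<Omega>. dist_bdry \<Omega> x") auto
  define R where "R = max 1 R0"
  have R: "dist_bdry \<Omega> x \<le> ennreal R" if "x \<in> \<Omega>" for x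
    using SUP_upper[OF that, of "dist_bdry \<Omega>"] unfolding R0
    by (rule order_trans) (intro ennreal_leI, simp add: R_def)
  define \<sigma> L where "\<sigma> = 1 / (2 * k ^ (2 * m))" and "L = 2 * k * R"
  have pos: "k \<ge> 1" "R > 0" "\<sigma> > 0" "L > 0"
    by (auto simp: k_def R_def \<sigma>_def L_def less_max_iff_disj zero_less_mult_iff)
  have "\<sigma> / (2 * L\<^sup>2) ^ m * (\<integral>x. (f x)\<^sup>2 \<partial>lborel) \<le> Eform m f f" if f: "test_fun \<Omega> f" for f
  proof -
    have "\<sigma> * (\<integral>x. (f x)\<^sup>2 \<partial>lborel) \<le> (2 * L\<^sup>2) ^ m * Eform m f f"
      using pos(4) near_exit_measure_ge[OF assms(1) _ assms(2) pos(1) k R]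
      by (intro poincare_of_near_exit[OF assms(1) _ f]) (auto simp: \<sigma>_def L_def)
    moreover have "(2 * L\<^sup>2) ^ m > 0" using pos by simp
    ultimately show ?thesis by (simp add: pos_divide_le_eq mult.commute)
  qed
  moreover have "\<sigma> / (2 * L\<^sup>2) ^ m > 0" using pos by simp
  ultimately show ?thesis by blast
qed

subsection \<open>Square integrable functions\<close>

text \<open>Formulated for an arbitrary measure because completeness is a fact about any measure; it
  is applied to \<open>lebesgue_on \<Omega>\<close>.\<close>

definition square_integrable :: "'a measure \<Rightarrow> ('a \<Rightarrow> real) \<Rightarrow> bool" where
  "square_integrable M f \<longleftrightarrow> f \<in> borel_measurable M \<and> integrable M (\<lambda>x. (f x)\<^sup>2)"

lemma square_integrable_mult:
  assumes "square_integrable M f" "square_integrable M g"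
  shows "integrable M (\<lambda>x. f x * g x)"
proof (rule Bochner_Integration.integrable_bound)
  show "integrable M (\<lambda>x. (f x)\<^sup>2 + (g x)\<^sup>2)"
    using assms by (simp add: square_integrable_def)
  show "(\<lambda>x. f x * g x) \<in> borel_measurable M"
    using assms by (intro borel_measurable_times) (simp_all add: square_integrable_def)
  have "\<bar>f x * g x\<bar> \<le> (f x)\<^sup>2 + (g x)\<^sup>2" for x
  proof -
    have "2 * (\<bar>f x\<bar> * \<bar>g x\<bar>) \<le> (f x)\<^sup>2 + (g x)\<^sup>2"
      using sum_squares_bound[of "\<bar>f x\<bar>" "\<bar>g x\<bar>"] by (simp add: mult.assoc)
    then show ?thesis
      using mult_nonneg_nonneg[of "\<bar>f x\<bar>" "\<bar>g x\<bar>"] unfolding abs_mult by linarith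
  qed
  then show "AE x in M. norm (f x * g x) \<le> norm ((f x)\<^sup>2 + (g x)\<^sup>2)"
    by simp
qed

lemma square_integrable_lincomb:
  assumes "square_integrable M f" "square_integrable M g"
  shows "square_integrable M (\<lambda>x. a * f x + b * g x)"
proof -
  have "integrable M (\<lambda>x. a\<^sup>2 * (f x)\<^sup>2 + 2 * a * b * (f x * g x) + b\<^sup>2 * (g x)\<^sup>2)"
    using assms square_integrable_mult[OF assms] by (simp add: square_integrable_def)
  moreover have "(a * f x + b * g x)\<^sup>2 = a\<^sup>2 * (f x)\<^sup>2 + 2 * a * b * (f x * g x) + b\<^sup>2 * (g x)\<^sup>2" for x
    by (simp add: power2_eq_square algebra_simps)
  ultimately show ?thesis
    using assms unfolding square_integrable_def by (simp add: borel_measurable_add borel_measurable_times)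
qed

lemma square_integrable_diff:
  assumes "square_integrable M f" "square_integrable M g"
  shows "square_integrable M (\<lambda>x. f x - g x)"
  using square_integrable_lincomb[OF assms, of 1 "-1"] by simp

text \<open>The sum of j and all thresholds up to \<open>N j\<close> is strictly increasing in j and
  dominates \<open>N j\<close>.\<close>

lemma ex_subseq_controlled:
  fixes P :: "nat \<Rightarrow> nat \<Rightarrow> nat \<Rightarrow> bool"
  assumes "\<And>j. \<exists>N. \<forall>n\<ge>N. \<forall>k\<ge>N. P j n k"
  shows "\<exists>r. strict_mono r \<and> (\<forall>j. \<forall>n\<ge>r j. \<forall>k\<ge>r j. P j n k)"
proof -
  obtain N where N: "\<And>j n k. n \<ge> N j \<Longrightarrow> k \<ge> N j \<Longrightarrow> P j n k"
    using assms by metis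
  define r where "r j = j + (\<Sum>i\<le>j. N i)" for j
  have "strict_mono r"
    by (rule strict_mono_Suc_iff[THEN iffD2]) (simp add: r_def)
  moreover have "N j \<le> r j" for j
    using member_le_sum[of j "{..j}" N] by (simp add: r_def)
  ultimately show ?thesis
    using N order_trans by blast
qed

text \<open>Riesz-Fischer: a fast subsequence converges almost everywhere, and Fatou turns the
  Cauchy bounds into bounds on the distance to the pointwise limit.\<close>

lemma square_integrable_complete:
  fixes \<phi> :: "nat \<Rightarrow> 'a \<Rightarrow> real"
  assumes sq: "\<And>n. square_integrable M (\<phi> n)"
    and cauchy: "\<And>e. e > 0 \<Longrightarrow> \<exists>N. \<forall>n\<ge>N. \<forall>k\<ge>N. (\<integral>x. (\<phi> n x - \<phi> k x)\<^sup>2 \<partial>M) < e"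
  shows "\<exists>f. square_integrable M f \<and> (\<lambda>n. \<integral>x. (\<phi> n x - f x)\<^sup>2 \<partial>M) \<longlonglongrightarrow> 0"
proof -
  have [measurable]: "\<phi> n \<in> borel_measurable M" for n
    using sq by (simp add: square_integrable_def)
  have int: "integrable M (\<lambda>x. (\<phi> n x - \<phi> k x)\<^sup>2)" for n k
    using square_integrable_diff[OF sq sq] by (simp add: square_integrable_def)
  have nn: "(\<integral>\<^sup>+x. ennreal ((\<phi> n x - \<phi> k x)\<^sup>2) \<partial>M) = ennreal (\<integral>x. (\<phi> n x - \<phi> k x)\<^sup>2 \<partial>M)" for n k
    by (rule nn_integral_eq_integral[OF int]) simp
  obtain r where r: "strict_mono r"
    "\<And>j n k. n \<ge> r j \<Longrightarrow> k \<ge> r j \<Longrightarrow> (\<integral>x. (\<phi> n x - \<phi> k x)\<^sup>2 \<partial>M) < (1/8) ^ j"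
    using ex_subseq_controlled[of "\<lambda>j n k. (\<integral>x. (\<phi> n x - \<phi> k x)\<^sup>2 \<partial>M) < (1/8) ^ j"] cauchy by force
  define \<delta> where "\<delta> j x = \<phi> (r (Suc j)) x - \<phi> (r j) x" for j x
  have [measurable]: "\<delta> j \<in> borel_measurable M" for j
    unfolding \<delta>_def by measurable
  \<comment> \<open>The weight 4^j serves both ends: integrals below 8^(-j) still add up to a
    geometric series of ratio 1/2, while a finite weighted sum at x forces the increments to decay
    like 2^(-j), hence to be summable.\<close>
  have "(\<integral>\<^sup>+x. (\<Sum>j. ennreal (4 ^ j * (\<delta> j x)\<^sup>2)) \<partial>M) = (\<Sum>j. \<integral>\<^sup>+x. ennreal (4 ^ j * (\<delta> j x)\<^sup>2) \<partial>M)"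
    by (rule nn_integral_suminf) measurable
  also have "\<dots> \<le> (\<Sum>j. ennreal ((1/2) ^ j))"
  proof (intro suminf_le summableI allI)
    fix j
    have "(\<integral>\<^sup>+x. ennreal (4 ^ j * (\<delta> j x)\<^sup>2) \<partial>M) = ennreal (4 ^ j) * (\<integral>\<^sup>+x. ennreal ((\<delta> j x)\<^sup>2) \<partial>M)"
      by (simp add: ennreal_mult nn_integral_cmult)
    also have "\<dots> \<le> ennreal (4 ^ j) * ennreal ((1/8) ^ j)"
      unfolding \<delta>_def nn using r(2)[of j "r (Suc j)" "r j"] strict_mono_leD[OF r(1), of j "Suc j"]
      by (intro mult_left_mono ennreal_leI) auto
    also have "\<dots> = ennreal ((1/2) ^ j)"
      by (simp flip: ennreal_mult power_mult_distrib)
    finally show "(\<integral>\<^sup>+x. ennreal (4 ^ j * (\<delta> j x)\<^sup>2) \<partial>M) \<le> ennreal ((1/2) ^ j)" .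
  qed
  also have "\<dots> < \<infinity>"
    by (subst suminf_ennreal2) (auto simp: summable_geometric)
  finally have "AE x in M. (\<Sum>j. ennreal (4 ^ j * (\<delta> j x)\<^sup>2)) \<noteq> \<infinity>"
    by (intro nn_integral_noteq_infinite) auto
  then have AE: "AE x in M. convergent (\<lambda>j. \<phi> (r j) x)"
  proof (rule eventually_mono)
    fix x assume fin: "(\<Sum>j. ennreal (4 ^ j * (\<delta> j x)\<^sup>2)) \<noteq> \<infinity>"
    define S where "S = (\<Sum>j. ennreal (4 ^ j * (\<delta> j x)\<^sup>2))"
    obtain C where C: "S = ennreal C" "C \<ge> 0"
      using fin unfolding S_def[symmetric] by (cases S) auto
    have "norm (\<delta> j x) \<le> sqrt C * (1/2) ^ j" for j
    proof -
      have "ennreal (4 ^ j * (\<delta> j x)\<^sup>2) \<le> ennreal C"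
        unfolding C(1)[symmetric] S_def using sum_le_suminf[OF summableI, of "{j}" "\<lambda>j. ennreal (4 ^ j * (\<delta> j x)\<^sup>2)"]
        by (simp only: sum.insert sum.empty finite.intros add_0_right empty_iff zero_le simp_thms)
      then have "4 ^ j * (\<delta> j x)\<^sup>2 \<le> C" using C(2) by simp
      moreover have "4 ^ j * (\<delta> j x)\<^sup>2 = (2 ^ j * \<delta> j x)\<^sup>2"
        by (simp add: power_mult_distrib flip: power_mult) (simp add: power_mult mult.commute[of j])
      ultimately have "\<bar>2 ^ j * \<delta> j x\<bar> \<le> sqrt C"
        by (metis real_sqrt_abs real_sqrt_le_mono)
      then show ?thesis
        by (simp add: abs_mult field_simps)
    qed
    then have "summable (\<lambda>j. \<delta> j x)"
      by (intro summable_comparison_test'[OF summable_mult[OF summable_geometric], of "1/2" 0 "\<lambda>j. \<delta> j x" "sqrt C"]) auto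
    then have "convergent (\<lambda>n. \<Sum>j<n. \<delta> j x)"
      by (simp add: summable_iff_convergent)
    moreover have "(\<Sum>j<n. \<delta> j x) = \<phi> (r n) x - \<phi> (r 0) x" for n
      by (simp add: \<delta>_def sum_lessThan_telescope[of "\<lambda>j. \<phi> (r j) x"])
    ultimately have "convergent (\<lambda>n. \<phi> (r n) x - \<phi> (r 0) x)" by simp
    from convergent_add[OF this convergent_const[of "\<phi> (r 0) x"]]
    show "convergent (\<lambda>j. \<phi> (r j) x)" by simp
  qed
  define f where "f x = lim (\<lambda>j. \<phi> (r j) x)" for x
  have [measurable]: "f \<in> borel_measurable M"
    unfolding f_def by measurable
  \<comment> \<open>The bound is assumed for all k >= N and applied to k = r j, which is at least
    j.\<close>
  have fatou: "(\<integral>\<^sup>+x. ennreal ((\<phi> n x - f x)\<^sup>2) \<partial>M) \<le> ennreal e"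
    if e: "\<And>k. k \<ge> N \<Longrightarrow> (\<integral>x. (\<phi> n x - \<phi> k x)\<^sup>2 \<partial>M) \<le> e" for n N e
  proof -
    have "(\<integral>\<^sup>+x. ennreal ((\<phi> n x - f x)\<^sup>2) \<partial>M) = (\<integral>\<^sup>+x. liminf (\<lambda>j. ennreal ((\<phi> n x - \<phi> (r j) x)\<^sup>2)) \<partial>M)"
    proof (intro nn_integral_cong_AE eventually_mono[OF AE])
      fix x assume "convergent (\<lambda>j. \<phi> (r j) x)"
      then have "(\<lambda>j. \<phi> (r j) x) \<longlonglongrightarrow> f x"
        unfolding f_def by (simp add: convergent_LIMSEQ_iff)
      then have "(\<lambda>j. ennreal ((\<phi> n x - \<phi> (r j) x)\<^sup>2)) \<longlonglongrightarrow> ennreal ((\<phi> n x - f x)\<^sup>2)"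
        by (intro tendsto_intros)
      then show "ennreal ((\<phi> n x - f x)\<^sup>2) = liminf (\<lambda>j. ennreal ((\<phi> n x - \<phi> (r j) x)\<^sup>2))"
        using lim_imp_Liminf by force
    qed
    also have "\<dots> \<le> liminf (\<lambda>j. \<integral>\<^sup>+x. ennreal ((\<phi> n x - \<phi> (r j) x)\<^sup>2) \<partial>M)"
      by (rule nn_integral_liminf) measurable
    also have "\<dots> \<le> liminf (\<lambda>j. ennreal e)"
      unfolding nn
      using seq_suble[OF r(1)] order_trans
      by (intro Liminf_mono eventually_sequentiallyI[of N] ennreal_leI e) blast
    also have "\<dots> = ennreal e" by (simp add: Liminf_const)
    finally show ?thesis .
  qed
  have tail: "\<exists>N. \<forall>n\<ge>N. integrable M (\<lambda>x. (\<phi> n x - f x)\<^sup>2) \<and> (\<integral>x. (\<phi> n x - f x)\<^sup>2 \<partial>M) < e" if "e > 0" for e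
  proof -
    obtain N where N: "\<And>n k. n \<ge> N \<Longrightarrow> k \<ge> N \<Longrightarrow> (\<integral>x. (\<phi> n x - \<phi> k x)\<^sup>2 \<partial>M) < e / 2"
      using cauchy[of "e / 2"] \<open>e > 0\<close> by force
    have "integrable M (\<lambda>x. (\<phi> n x - f x)\<^sup>2) \<and> (\<integral>x. (\<phi> n x - f x)\<^sup>2 \<partial>M) < e" if "n \<ge> N" for n
    proof -
      have le: "(\<integral>\<^sup>+x. ennreal ((\<phi> n x - f x)\<^sup>2) \<partial>M) \<le> ennreal (e / 2)"
        using N that by (intro fatou[of N]) (auto intro: less_imp_le)
      then have int: "integrable M (\<lambda>x. (\<phi> n x - f x)\<^sup>2)"
        by (intro integrableI_nonneg) (auto intro: le_less_trans)
      then show ?thesis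
        using le \<open>e > 0\<close> by (auto simp: nn_integral_eq_integral)
    qed
    then show ?thesis by blast
  qed
  obtain n where "integrable M (\<lambda>x. (\<phi> n x - f x)\<^sup>2)"
    using tail[of 1] by auto
  then have "square_integrable M (\<lambda>x. \<phi> n x - f x)"
    by (simp add: square_integrable_def)
  from square_integrable_diff[OF sq this, of n] have "square_integrable M f"
    by simp
  moreover have "(\<lambda>n. \<integral>x. (\<phi> n x - f x)\<^sup>2 \<partial>M) \<longlonglongrightarrow> 0"
  proof (rule LIMSEQ_I)
    fix e :: real assume "e > 0"
    then show "\<exists>N. \<forall>n\<ge>N. norm ((\<integral>x. (\<phi> n x - f x)\<^sup>2 \<partial>M) - 0) < e"
      using tail[of e] by auto
  qed
  ultimately show ?thesis by blast
qed

subsection \<open>The closed form and its operator\<close>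

lemma L2_iff:
  fixes \<Omega> :: "'a::euclidean_space set"
  assumes "open \<Omega>"
  shows "L2 \<Omega> f \<longleftrightarrow> square_integrable (lebesgue_on \<Omega>) f"
  using assms unfolding L2_def square_integrable_def set_integrable_def
  by (simp add: integrable_restrict_space)

lemma L2_inner_eq:
  fixes \<Omega> :: "'a::euclidean_space set"
  assumes "open \<Omega>"
  shows "L2_inner \<Omega> f g = (\<integral>x. f x * g x \<partial>lebesgue_on \<Omega>)"
  using assms unfolding L2_inner_def set_lebesgue_integral_def
  by (simp add: integral_restrict_space)

lemma L2_inner_commute: "L2_inner \<Omega> f g = L2_inner \<Omega> g f"
  by (simp add: L2_inner_def mult.commute)

lemma L2_inner_nonneg: "0 \<le> L2_inner \<Omega> f f"
  unfolding L2_inner_def set_lebesgue_integral_def by (intro Bochner_Integration.integral_nonneg) simp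

lemma L2_norm_nonneg: "0 \<le> L2_norm \<Omega> f"
  by (simp add: L2_norm_def L2_inner_nonneg)

lemma L2_norm_power2: "(L2_norm \<Omega> f)\<^sup>2 = L2_inner \<Omega> f f"
  by (simp add: L2_norm_def L2_inner_nonneg)

text \<open>For c > 0 the minimising t = -b/c is inserted; for c = 0 a nonzero b would make the
  expression negative somewhere. It serves both Cauchy-Schwarz inequalities and the perturbation
  argument for the minimising sequence.\<close>

lemma discriminant_bound:
  fixes a b c :: real
  assumes "\<And>t. 0 \<le> a + 2 * t * b + t\<^sup>2 * c" "0 \<le> c"
  shows "b\<^sup>2 \<le> a * c"
proof (cases "c = 0")
  case True
  have "b = 0"
  proof (rule ccontr)
    assume "b \<noteq> 0"
    then have "2 * (- (\<bar>a\<bar> + 1) / (2 * b)) * b = - (\<bar>a\<bar> + 1)"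
      by simp
    then show False
      using assms(1)[of "- (\<bar>a\<bar> + 1) / (2 * b)"] True abs_ge_self[of a] by simp
  qed
  then show ?thesis using True by simp
next
  case False
  then have "c > 0" using assms(2) by simp
  have "a + 2 * (- b / c) * b + (- b / c)\<^sup>2 * c = a - b\<^sup>2 / c"
    using False by (simp add: power2_eq_square field_simps)
  then have "b\<^sup>2 / c \<le> a"
    using assms(1)[of "- b / c"] by simp
  then show ?thesis
    using \<open>c > 0\<close> by (simp add: pos_divide_le_eq)
qed

lemma test_fun_diff:
  fixes f g :: "'a::euclidean_space \<Rightarrow> real"
  assumes "test_fun \<Omega> f" "test_fun \<Omega> g" shows "test_fun \<Omega> (\<lambda>x. f x - g x)"
  using test_fun_lincomb[OF assms, of 1 "-1"] by simp

lemma Eform_lincomb_square: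
  assumes "test_fun \<Omega> f" "test_fun \<Omega> g"
  shows "Eform m (\<lambda>x. a * f x + b * g x) (\<lambda>x. a * f x + b * g x)
    = a\<^sup>2 * Eform m f f + 2 * a * b * Eform m f g + b\<^sup>2 * Eform m g g"
proof -
  have t: "test_fun UNIV f" "test_fun UNIV g"
    using assms by (auto intro: test_fun_mono)
  note l = test_fun_lincomb[OF t, of a b]
  have "Eform m (\<lambda>x. a * f x + b * g x) (\<lambda>x. a * f x + b * g x)
      = a * Eform m f (\<lambda>x. a * f x + b * g x) + b * Eform m g (\<lambda>x. a * f x + b * g x)"
    by (rule Eform_lincomb[OF t l])
  also have "\<dots> = a * Eform m (\<lambda>x. a * f x + b * g x) f + b * Eform m (\<lambda>x. a * f x + b * g x) g"
    by (simp add: Eform_commute)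
  also have "\<dots> = a\<^sup>2 * Eform m f f + 2 * a * b * Eform m f g + b\<^sup>2 * Eform m g g"
    using t by (simp add: Eform_lincomb Eform_commute[of m g f] power2_eq_square algebra_simps)
  finally show ?thesis .
qed

lemma Eform_Cauchy_Schwarz:
  assumes "test_fun \<Omega> f" "test_fun \<Omega> g"
  shows "(Eform m f g)\<^sup>2 \<le> Eform m f f * Eform m g g"
proof -
  have "0 \<le> Eform m f f + 2 * t * Eform m f g + t\<^sup>2 * Eform m g g" for t
    using Eform_lincomb_square[OF assms, of m 1 t]
      Eform_nonneg[of m "\<lambda>x. 1 * f x + t * g x"] by simp
  then show ?thesis
    by (rule discriminant_bound) (rule Eform_nonneg)
qed

text \<open>The parallelogram identity with the term q(f + g) dropped.\<close>

lemma Eform_diff_le: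
  assumes "test_fun \<Omega> f" "test_fun \<Omega> g"
  shows "Eform m (\<lambda>x. f x - g x) (\<lambda>x. f x - g x) \<le> 2 * Eform m f f + 2 * Eform m g g"
  using Eform_lincomb_square[OF assms, of m 1 "-1"] Eform_lincomb_square[OF assms, of m 1 1]
    Eform_nonneg[of m "\<lambda>x. f x + g x"] by simp

context
  fixes \<Omega> :: "'a::euclidean_space set"
  assumes open_\<Omega>: "open \<Omega>"
begin

lemma L2_lincomb: "L2 \<Omega> f \<Longrightarrow> L2 \<Omega> g \<Longrightarrow> L2 \<Omega> (\<lambda>x. a * f x + b * g x)"
  by (simp add: L2_iff open_\<Omega> square_integrable_lincomb)

lemma L2_diff: "L2 \<Omega> f \<Longrightarrow> L2 \<Omega> g \<Longrightarrow> L2 \<Omega> (\<lambda>x. f x - g x)"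
  by (simp add: L2_iff open_\<Omega> square_integrable_diff)

lemma L2_inner_lincomb:
  assumes "L2 \<Omega> f" "L2 \<Omega> g" "L2 \<Omega> h"
  shows "L2_inner \<Omega> (\<lambda>x. a * f x + b * g x) h = a * L2_inner \<Omega> f h + b * L2_inner \<Omega> g h"
proof -
  have "integrable (lebesgue_on \<Omega>) (\<lambda>x. f x * h x)" "integrable (lebesgue_on \<Omega>) (\<lambda>x. g x * h x)"
    using assms by (auto simp: L2_iff open_\<Omega> intro: square_integrable_mult)
  then show ?thesis
    by (simp add: L2_inner_eq open_\<Omega> distrib_right mult.assoc)
qed

lemma L2_inner_lincomb_square:
  assumes "L2 \<Omega> f" "L2 \<Omega> g"
  shows "L2_inner \<Omega> (\<lambda>x. a * f x + b * g x) (\<lambda>x. a * f x + b * g x)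
    = a\<^sup>2 * L2_inner \<Omega> f f + 2 * a * b * L2_inner \<Omega> f g + b\<^sup>2 * L2_inner \<Omega> g g"
proof -
  note l = L2_lincomb[OF assms, of a b]
  have "L2_inner \<Omega> (\<lambda>x. a * f x + b * g x) (\<lambda>x. a * f x + b * g x)
      = a * L2_inner \<Omega> f (\<lambda>x. a * f x + b * g x) + b * L2_inner \<Omega> g (\<lambda>x. a * f x + b * g x)"
    by (rule L2_inner_lincomb[OF assms l])
  also have "\<dots> = a * L2_inner \<Omega> (\<lambda>x. a * f x + b * g x) f + b * L2_inner \<Omega> (\<lambda>x. a * f x + b * g x) g"
    by (simp add: L2_inner_commute)
  also have "\<dots> = a\<^sup>2 * L2_inner \<Omega> f f + 2 * a * b * L2_inner \<Omega> f g + b\<^sup>2 * L2_inner \<Omega> g g"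
    using assms by (simp add: L2_inner_lincomb L2_inner_commute[of \<Omega> g f] power2_eq_square algebra_simps)
  finally show ?thesis .
qed

lemma L2_Cauchy_Schwarz:
  assumes "L2 \<Omega> f" "L2 \<Omega> g"
  shows "\<bar>L2_inner \<Omega> f g\<bar> \<le> L2_norm \<Omega> f * L2_norm \<Omega> g"
proof -
  have "0 \<le> L2_inner \<Omega> f f + 2 * t * L2_inner \<Omega> f g + t\<^sup>2 * L2_inner \<Omega> g g" for t
    using L2_inner_lincomb_square[OF assms, of 1 t]
      L2_inner_nonneg[of \<Omega> "\<lambda>x. 1 * f x + t * g x"] by simp
  then have "(L2_inner \<Omega> f g)\<^sup>2 \<le> L2_inner \<Omega> f f * L2_inner \<Omega> g g"
    by (rule discriminant_bound) (rule L2_inner_nonneg)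
  then show ?thesis
    unfolding L2_norm_def real_sqrt_mult[symmetric] by (metis real_sqrt_abs real_sqrt_le_mono)
qed

lemma L2_triangle:
  assumes "L2 \<Omega> f" "L2 \<Omega> g"
  shows "L2_norm \<Omega> (\<lambda>x. f x - g x) \<le> L2_norm \<Omega> f + L2_norm \<Omega> g"
proof -
  have "(L2_norm \<Omega> (\<lambda>x. f x - g x))\<^sup>2 = (L2_norm \<Omega> f)\<^sup>2 - 2 * L2_inner \<Omega> f g + (L2_norm \<Omega> g)\<^sup>2"
    using L2_inner_lincomb_square[OF assms, of 1 "-1"] by (simp add: L2_norm_power2)
  also have "\<dots> \<le> (L2_norm \<Omega> f + L2_norm \<Omega> g)\<^sup>2"
    using L2_Cauchy_Schwarz[OF assms] by (simp add: power2_sum)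
  finally show ?thesis
    by (rule power2_le_imp_le) (simp add: L2_norm_nonneg)
qed

lemma test_fun_L2:
  assumes "test_fun \<Omega> f" shows "L2 \<Omega> f"
proof -
  have f: "test_fun UNIV f" using test_fun_mono[OF assms] by simp
  have meas: "f \<in> borel_measurable borel"
    by (intro borel_measurable_continuous_onI smooth_continuous test_funD[OF f])
  have "integrable lborel (\<lambda>x. (f x)\<^sup>2)"
    using test_fun_integrable_mult[OF f f] by (simp add: power2_eq_square)
  then have "integrable lebesgue (\<lambda>x. (f x)\<^sup>2)"
    using meas by (subst integrable_completion) auto
  then have "set_integrable lebesgue \<Omega> (\<lambda>x. (f x)\<^sup>2)"
    using open_\<Omega> unfolding set_integrable_def by (intro integrable_mult_indicator) auto
  moreover have "f \<in> borel_measurable (lebesgue_on \<Omega>)"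
    using meas by (intro measurable_restrict_space1) (simp add: measurable_completion)
  ultimately show ?thesis by (simp add: L2_def)
qed

lemma L2_inner_test_fun:
  assumes "test_fun \<Omega> f" "test_fun \<Omega> g"
  shows "L2_inner \<Omega> f g = (\<integral>x. f x * g x \<partial>lborel)"
proof -
  have [measurable]: "f \<in> borel_measurable borel" "g \<in> borel_measurable borel"
    by (intro borel_measurable_continuous_onI smooth_continuous test_funD[OF assms(1)] test_funD[OF assms(2)])+
  have "L2_inner \<Omega> f g = (\<integral>x. f x * g x \<partial>lebesgue)"
    unfolding L2_inner_def set_lebesgue_integral_def
    by (intro Bochner_Integration.integral_cong refl)
       (auto simp: indicator_def test_fun_eq_0[OF assms(1)])
  also have "\<dots> = (\<integral>x. f x * g x \<partial>lborel)"
    by (rule integral_completion) measurable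
  finally show ?thesis .
qed

text \<open>The passage from an integral over \<Omega> for completed Lebesgue measure to sums over
  the whole space, where positivity and Cauchy-Schwarz are available.\<close>

lemma Qm_eq_Eform:
  assumes "test_fun \<Omega> f" "test_fun \<Omega> g"
  shows "Qm \<Omega> m f g = Eform m f g"
  unfolding Qm_def L2_inner_test_fun[OF test_fun_polylap[OF assms(1)] assms(2)]
  by (intro integral_polylap test_fun_mono[OF assms(1)] test_fun_mono[OF assms(2)]) simp_all

lemma form_approx_iff:
  "form_approx \<Omega> m \<phi> f \<longleftrightarrow> (\<forall>n. test_fun \<Omega> (\<phi> n))
     \<and> (\<lambda>n. L2_norm \<Omega> (\<lambda>x. \<phi> n x - f x)) \<longlonglongrightarrow> 0
     \<and> (\<forall>e>0. \<exists>M. \<forall>n\<ge>M. \<forall>k\<ge>M. Eform m (\<lambda>x. \<phi> n x - \<phi> k x) (\<lambda>x. \<phi> n x - \<phi> k x) < e)"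
  unfolding form_approx_def by (intro conj_cong refl) (simp add: Qm_eq_Eform test_fun_diff)

lemma form_approx_const:
  assumes "test_fun \<Omega> f" shows "form_approx \<Omega> m (\<lambda>n. f) f"
proof -
  have "Eform m (\<lambda>x::'a. 0) (\<lambda>x. 0) = 0" for m
    by (induction m) (simp_all add: dderiv_zero)
  then show ?thesis
    using assms by (simp add: form_approx_iff L2_norm_def L2_inner_def)
qed

lemma test_fun_form_dom: "test_fun \<Omega> f \<Longrightarrow> form_dom \<Omega> m f"
  unfolding form_dom_def using form_approx_const test_fun_L2 by blast

lemma form_approx_bounded:
  assumes "form_approx \<Omega> m \<phi> f"
  shows "\<exists>B\<ge>0. \<forall>\<^sub>F n in sequentially. Eform m (\<phi> n) (\<phi> n) \<le> B"
proof -
  have t: "test_fun \<Omega> (\<phi> n)" for n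
    using assms by (simp add: form_approx_iff)
  obtain M where M: "\<And>n k. n \<ge> M \<Longrightarrow> k \<ge> M \<Longrightarrow> Eform m (\<lambda>x. \<phi> n x - \<phi> k x) (\<lambda>x. \<phi> n x - \<phi> k x) < 1"
    using assms zero_less_one unfolding form_approx_iff by blast
  have "Eform m (\<phi> n) (\<phi> n) \<le> 2 + 2 * Eform m (\<phi> M) (\<phi> M)" if "n \<ge> M" for n
  proof -
    \<comment> \<open>Read as u_n = (u_n - u_M) - (-u_M). The function -u_M is spelled with
      coefficients -1 and 0 so that the square formula for linear combinations applies.\<close>
    have e: "(\<lambda>x. (\<phi> n x - \<phi> M x) - (-1 * \<phi> M x + 0 * \<phi> M x)) = \<phi> n" by auto
    have "Eform m (\<lambda>x. -1 * \<phi> M x + 0 * \<phi> M x) (\<lambda>x. -1 * \<phi> M x + 0 * \<phi> M x) = Eform m (\<phi> M) (\<phi> M)"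
      unfolding Eform_lincomb_square[OF t t] by simp
    then show ?thesis
      using Eform_diff_le[OF test_fun_diff[OF t t] test_fun_lincomb[OF t t], of m n M "-1" M 0 M] M[of n M] that
      unfolding e by simp
  qed
  then have "\<forall>\<^sub>F n in sequentially. Eform m (\<phi> n) (\<phi> n) \<le> 2 + 2 * Eform m (\<phi> M) (\<phi> M)"
    using eventually_sequentially by blast
  moreover have "0 \<le> 2 + 2 * Eform m (\<phi> M) (\<phi> M)"
    by (simp add: Eform_nonneg)
  ultimately show ?thesis by blast
qed

text \<open>Closability: let \<open>k \<rightarrow> \<infinity>\<close> in \<open>q(u\<^sub>n - u\<^sub>k) \<ge> q(u\<^sub>n) - 2 q(u\<^sub>n, u\<^sub>k)\<close>, where
  \<open>q(u\<^sub>n, u\<^sub>k) = \<langle>(-\<Delta>)\<^sup>m u\<^sub>n, u\<^sub>k\<rangle> \<rightarrow> 0\<close>.\<close>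
lemma form_approx_zero:
  assumes "form_approx \<Omega> m u (\<lambda>x. 0)"
  shows "(\<lambda>n. Eform m (u n) (u n)) \<longlonglongrightarrow> 0"
proof (rule LIMSEQ_I)
  fix e :: real assume "e > 0"
  have t: "test_fun \<Omega> (u n)" for n
    using assms by (simp add: form_approx_iff)
  obtain M where M: "\<And>n k. n \<ge> M \<Longrightarrow> k \<ge> M \<Longrightarrow> Eform m (\<lambda>x. u n x - u k x) (\<lambda>x. u n x - u k x) < e / 2"
    using assms half_gt_zero[OF \<open>e > 0\<close>] unfolding form_approx_iff by blast
  have "Eform m (u n) (u n) \<le> e / 2" if "n \<ge> M" for n
  proof -
    have lim: "(\<lambda>k. Eform m (u n) (u k)) \<longlonglongrightarrow> 0"
    proof (rule Lim_null_comparison)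
      show "\<forall>\<^sub>F k in sequentially. norm (Eform m (u n) (u k)) \<le> L2_norm \<Omega> (polylap m (u n)) * L2_norm \<Omega> (u k)"
        using L2_Cauchy_Schwarz[OF test_fun_L2[OF test_fun_polylap[OF t]] test_fun_L2[OF t]]
        by (simp add: Qm_eq_Eform[OF t t, symmetric] Qm_def)
      have "(\<lambda>k. L2_norm \<Omega> (u k)) \<longlonglongrightarrow> 0"
        using assms by (simp add: form_approx_iff)
      then show "(\<lambda>k. L2_norm \<Omega> (polylap m (u n)) * L2_norm \<Omega> (u k)) \<longlonglongrightarrow> 0"
        by (rule tendsto_mult_right_zero)
    qed
    have "Eform m (u n) (u n) \<le> e / 2 + 2 * Eform m (u n) (u k)" if "k \<ge> M" for k
      using Eform_lincomb_square[OF t t, of m 1 n "-1" k] M[OF \<open>n \<ge> M\<close> that] Eform_nonneg[of m "u k"]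
      by simp
    then have "\<forall>\<^sub>F k in sequentially. Eform m (u n) (u n) \<le> e / 2 + 2 * Eform m (u n) (u k)"
      using eventually_sequentially by blast
    moreover have "(\<lambda>k. e / 2 + 2 * Eform m (u n) (u k)) \<longlonglongrightarrow> e / 2 + 2 * 0"
      by (intro tendsto_intros lim)
    ultimately show ?thesis
      using tendsto_lowerbound[OF _ _ sequentially_bot] by fastforce
  qed
  then have "\<forall>n\<ge>M. norm (Eform m (u n) (u n) - 0) < e"
    using \<open>e > 0\<close> by (fastforce simp: Eform_nonneg)
  then show "\<exists>N. \<forall>n\<ge>N. norm (Eform m (u n) (u n) - 0) < e" ..
qed

text \<open>With closability this shows that form values do not depend on the approximating
  sequence: two approximations of one f differ by a sequence whose form values tend to 0.\<close>

lemma form_approx_diff: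
  assumes "L2 \<Omega> f" and \<phi>: "form_approx \<Omega> m \<phi> f" and \<psi>: "form_approx \<Omega> m \<psi> f"
  shows "form_approx \<Omega> m (\<lambda>n x. \<phi> n x - \<psi> n x) (\<lambda>x. 0)"
  unfolding form_approx_iff
proof (intro conjI allI impI)
  have t: "test_fun \<Omega> (\<phi> n)" "test_fun \<Omega> (\<psi> n)" for n
    using assms by (simp_all add: form_approx_iff)
  then show "test_fun \<Omega> (\<lambda>x. \<phi> n x - \<psi> n x)" for n
    by (simp add: test_fun_diff)
  have "L2_norm \<Omega> (\<lambda>x. (\<phi> n x - f x) - (\<psi> n x - f x))
      \<le> L2_norm \<Omega> (\<lambda>x. \<phi> n x - f x) + L2_norm \<Omega> (\<lambda>x. \<psi> n x - f x)" for n
    by (intro L2_triangle L2_diff test_fun_L2 t assms)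
  then have "\<forall>\<^sub>F n in sequentially. norm (L2_norm \<Omega> (\<lambda>x. \<phi> n x - \<psi> n x - 0))
      \<le> L2_norm \<Omega> (\<lambda>x. \<phi> n x - f x) + L2_norm \<Omega> (\<lambda>x. \<psi> n x - f x)"
    by (simp add: L2_norm_nonneg)
  moreover have "(\<lambda>n. L2_norm \<Omega> (\<lambda>x. \<phi> n x - f x) + L2_norm \<Omega> (\<lambda>x. \<psi> n x - f x)) \<longlonglongrightarrow> 0"
    using \<phi> \<psi> unfolding form_approx_iff by (intro tendsto_add_zero) auto
  ultimately show "(\<lambda>n. L2_norm \<Omega> (\<lambda>x. \<phi> n x - \<psi> n x - 0)) \<longlonglongrightarrow> 0"
    by (rule Lim_null_comparison)
  fix e :: real assume "e > 0"
  then have "e / 4 > 0" by simp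
  obtain M1 where M1: "\<And>n k. n \<ge> M1 \<Longrightarrow> k \<ge> M1 \<Longrightarrow> Eform m (\<lambda>x. \<phi> n x - \<phi> k x) (\<lambda>x. \<phi> n x - \<phi> k x) < e / 4"
    using \<phi> \<open>e / 4 > 0\<close> unfolding form_approx_iff by blast
  obtain M2 where M2: "\<And>n k. n \<ge> M2 \<Longrightarrow> k \<ge> M2 \<Longrightarrow> Eform m (\<lambda>x. \<psi> n x - \<psi> k x) (\<lambda>x. \<psi> n x - \<psi> k x) < e / 4"
    using \<psi> \<open>e / 4 > 0\<close> unfolding form_approx_iff by blast
  have "Eform m (\<lambda>x. (\<phi> n x - \<psi> n x) - (\<phi> k x - \<psi> k x)) (\<lambda>x. (\<phi> n x - \<psi> n x) - (\<phi> k x - \<psi> k x)) < e"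
    if "n \<ge> max M1 M2" "k \<ge> max M1 M2" for n k
  proof -
    have "(\<lambda>x. (\<phi> n x - \<psi> n x) - (\<phi> k x - \<psi> k x)) = (\<lambda>x. (\<phi> n x - \<phi> k x) - (\<psi> n x - \<psi> k x))"
      by (auto simp: algebra_simps)
    then show ?thesis
      using Eform_diff_le[OF test_fun_diff[OF t(1)[of n] t(1)[of k]] test_fun_diff[OF t(2)[of n] t(2)[of k]], of m]
        M1[of n k] M2[of n k] that by simp
  qed
  then show "\<exists>M. \<forall>n\<ge>M. \<forall>k\<ge>M. Eform m (\<lambda>x. (\<phi> n x - \<psi> n x) - (\<phi> k x - \<psi> k x))
      (\<lambda>x. (\<phi> n x - \<psi> n x) - (\<phi> k x - \<psi> k x)) < e"
    by blast
qed

lemma form_approx_L2_norm: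
  assumes "L2 \<Omega> f" "form_approx \<Omega> m \<phi> f"
  shows "(\<lambda>n. L2_norm \<Omega> (\<phi> n)) \<longlonglongrightarrow> L2_norm \<Omega> f"
proof -
  have t: "L2 \<Omega> (\<phi> n)" for n
    using assms by (simp add: form_approx_iff test_fun_L2)
  have "\<bar>L2_norm \<Omega> (\<phi> n) - L2_norm \<Omega> f\<bar> \<le> L2_norm \<Omega> (\<lambda>x. \<phi> n x - f x)" for n
  proof -
    have "L2_norm \<Omega> (\<lambda>x. \<phi> n x - (\<phi> n x - f x)) \<le> L2_norm \<Omega> (\<phi> n) + L2_norm \<Omega> (\<lambda>x. \<phi> n x - f x)"
      by (intro L2_triangle L2_diff t assms)
    moreover have "L2_norm \<Omega> (\<lambda>x. (\<phi> n x - f x) - (-1 * f x + 0 * f x)) \<le> L2_norm \<Omega> (\<lambda>x. \<phi> n x - f x) + L2_norm \<Omega> (\<lambda>x. -1 * f x + 0 * f x)"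
      by (intro L2_triangle L2_diff L2_lincomb t assms)
    moreover have "L2_norm \<Omega> (\<lambda>x. -1 * f x + 0 * f x) = L2_norm \<Omega> f"
      unfolding L2_norm_def L2_inner_lincomb_square[OF assms(1) assms(1)] by simp
    ultimately show ?thesis by simp
  qed
  then have "\<forall>\<^sub>F n in sequentially. norm (L2_norm \<Omega> (\<phi> n) - L2_norm \<Omega> f) \<le> L2_norm \<Omega> (\<lambda>x. \<phi> n x - f x)"
    by (intro always_eventually allI) simp
  moreover have "(\<lambda>n. L2_norm \<Omega> (\<lambda>x. \<phi> n x - f x)) \<longlonglongrightarrow> 0"
    using assms(2) by (simp add: form_approx_iff)
  ultimately have "(\<lambda>n. L2_norm \<Omega> (\<phi> n) - L2_norm \<Omega> f) \<longlonglongrightarrow> 0"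
    by (rule Lim_null_comparison)
  then show ?thesis by (simp add: LIM_zero_iff)
qed

lemma form_approx_L2_inner:
  assumes "L2 \<Omega> g" "L2 \<Omega> f" "form_approx \<Omega> m \<phi> f"
  shows "(\<lambda>n. L2_inner \<Omega> g (\<phi> n)) \<longlonglongrightarrow> L2_inner \<Omega> g f"
proof -
  have t: "L2 \<Omega> (\<phi> n)" for n
    using assms by (simp add: form_approx_iff test_fun_L2)
  have "\<bar>L2_inner \<Omega> g (\<phi> n) - L2_inner \<Omega> g f\<bar> \<le> L2_norm \<Omega> g * L2_norm \<Omega> (\<lambda>x. \<phi> n x - f x)" for n
  proof -
    have "L2_inner \<Omega> g (\<phi> n) - L2_inner \<Omega> g f = L2_inner \<Omega> g (\<lambda>x. \<phi> n x - f x)"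
      using L2_inner_lincomb[OF t assms(2,1), of 1 n "-1"] by (simp add: L2_inner_commute[of \<Omega> g])
    then show ?thesis
      using L2_Cauchy_Schwarz[OF assms(1) L2_diff[OF t assms(2)]] by simp
  qed
  then have "\<forall>\<^sub>F n in sequentially. norm (L2_inner \<Omega> g (\<phi> n) - L2_inner \<Omega> g f)
      \<le> L2_norm \<Omega> g * L2_norm \<Omega> (\<lambda>x. \<phi> n x - f x)"
    by (intro always_eventually allI) simp
  moreover have "(\<lambda>n. L2_norm \<Omega> g * L2_norm \<Omega> (\<lambda>x. \<phi> n x - f x)) \<longlonglongrightarrow> 0"
    using assms(3) unfolding form_approx_iff by (intro tendsto_mult_right_zero) auto
  ultimately have "(\<lambda>n. L2_inner \<Omega> g (\<phi> n) - L2_inner \<Omega> g f) \<longlonglongrightarrow> 0"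
    by (rule Lim_null_comparison)
  then show ?thesis by (simp add: LIM_zero_iff)
qed

end

section \<open>From coercivity to a bounded inverse\<close>

lemma tendsto_sqrt_inverse_Suc: "(\<lambda>n. sqrt (1 / Suc n)) \<longlonglongrightarrow> 0"
  using tendsto_real_sqrt[OF LIMSEQ_inverse_real_of_nat] by (simp add: inverse_eq_divide)

context
  fixes \<Omega> :: "'a::euclidean_space set" and m :: nat and c :: real
  assumes open_\<Omega>: "open \<Omega>" and c: "c > 0"
    and coercive: "\<And>f. test_fun \<Omega> f \<Longrightarrow> c * (L2_norm \<Omega> f)\<^sup>2 \<le> Eform m f f"
begin

text \<open>A minimising sequence of \<open>q(\<phi>) - 2 \<langle>g, \<phi>\<rangle>\<close> on the test functions: perturbing \<open>\<phi>\<^sub>n\<close> by \<open>t \<psi>\<close>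
  gives the Euler-Lagrange equation up to the square root of the defect of \<open>\<phi>\<^sub>n\<close>.\<close>
lemma ex_minimising_sequence:
  assumes g: "L2 \<Omega> g"
  shows "\<exists>\<phi>. (\<forall>n. test_fun \<Omega> (\<phi> n)) \<and>
    (\<forall>n \<psi>. test_fun \<Omega> \<psi> \<longrightarrow> \<bar>Eform m (\<phi> n) \<psi> - L2_inner \<Omega> g \<psi>\<bar> \<le> sqrt (1 / Suc n) * sqrt (Eform m \<psi> \<psi>))"
proof -
  define J where "J \<phi> = Eform m \<phi> \<phi> - 2 * L2_inner \<Omega> g \<phi>" for \<phi>
  have lower: "- ((L2_norm \<Omega> g)\<^sup>2 / c) \<le> J \<phi>" if "test_fun \<Omega> \<phi>" for \<phi>
  proof -
    have "L2_inner \<Omega> g \<phi> \<le> L2_norm \<Omega> g * L2_norm \<Omega> \<phi>"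
      using L2_Cauchy_Schwarz[OF open_\<Omega> g test_fun_L2[OF open_\<Omega> that]] by simp
    then have "c * (L2_norm \<Omega> \<phi>)\<^sup>2 - 2 * (L2_norm \<Omega> g * L2_norm \<Omega> \<phi>) \<le> J \<phi>"
      using coercive[OF that] by (simp add: J_def)
    \<comment> \<open>Completing the square in the norm of \<phi>; this bounds J from below.\<close>
    moreover have "c * (L2_norm \<Omega> \<phi>)\<^sup>2 - 2 * (L2_norm \<Omega> g * L2_norm \<Omega> \<phi>) + (L2_norm \<Omega> g)\<^sup>2 / c
        = (c * L2_norm \<Omega> \<phi> - L2_norm \<Omega> g)\<^sup>2 / c"
      using c by (simp add: power2_eq_square field_simps)
    moreover have "0 \<le> (c * L2_norm \<Omega> \<phi> - L2_norm \<Omega> g)\<^sup>2 / c"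
      using c by simp
    ultimately show ?thesis by linarith
  qed
  define S where "S = J ` {\<phi>. test_fun \<Omega> \<phi>}"
  have S: "S \<noteq> {}" "bdd_below S"
    using lower test_fun_zero by (auto simp: S_def intro!: bdd_belowI2)
  have "\<exists>\<phi>. test_fun \<Omega> \<phi> \<and> J \<phi> < Inf S + 1 / Suc n" for n
    using cInf_less_iff[OF S, of "Inf S + 1 / Suc n"] by (auto simp: S_def)
  then obtain \<phi> where \<phi>: "\<And>n. test_fun \<Omega> (\<phi> n)" "\<And>n. J (\<phi> n) < Inf S + 1 / Suc n"
    by metis
  have "\<bar>Eform m (\<phi> n) \<psi> - L2_inner \<Omega> g \<psi>\<bar> \<le> sqrt (1 / Suc n) * sqrt (Eform m \<psi> \<psi>)"
    if \<psi>: "test_fun \<Omega> \<psi>" for n \<psi>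
  proof -
    have "0 \<le> 1 / Suc n + 2 * t * (Eform m (\<phi> n) \<psi> - L2_inner \<Omega> g \<psi>) + t\<^sup>2 * Eform m \<psi> \<psi>" for t
    proof -
      have "Inf S \<le> J (\<lambda>x. 1 * \<phi> n x + t * \<psi> x)"
        by (rule cInf_lower[OF _ S(2)]) (unfold S_def, intro imageI CollectI test_fun_lincomb \<phi>(1) \<psi>)
      also have "\<dots> = J (\<phi> n) + 2 * t * (Eform m (\<phi> n) \<psi> - L2_inner \<Omega> g \<psi>) + t\<^sup>2 * Eform m \<psi> \<psi>"
        unfolding J_def Eform_lincomb_square[OF \<phi>(1) \<psi>] L2_inner_commute[of \<Omega> g]
          L2_inner_lincomb[OF open_\<Omega> test_fun_L2[OF open_\<Omega> \<phi>(1)] test_fun_L2[OF open_\<Omega> \<psi>] g]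
        by (simp add: algebra_simps)
      finally show ?thesis using \<phi>(2)[of n] by linarith
    qed
    then have "(Eform m (\<phi> n) \<psi> - L2_inner \<Omega> g \<psi>)\<^sup>2 \<le> 1 / Suc n * Eform m \<psi> \<psi>"
      by (rule discriminant_bound) (rule Eform_nonneg)
    then show ?thesis
      unfolding real_sqrt_mult[symmetric] by (metis real_sqrt_abs real_sqrt_le_mono)
  qed
  with \<phi>(1) show ?thesis by blast
qed

text \<open>Testing the relations for n and k with \<psi> = \<phi> n - \<phi> k cancels the terms in
  g, so the square root of q(\<psi>) is at most the sum of the two defects. Coercivity turns this
  form-Cauchy property into an L2 one, and completeness supplies f.\<close>

lemma minimising_sequence_converges:
  assumes \<phi>: "\<And>n. test_fun \<Omega> (\<phi> n)"
    and EL: "\<And>n \<psi>. test_fun \<Omega> \<psi> \<Longrightarrow> \<bar>Eform m (\<phi> n) \<psi> - L2_inner \<Omega> g \<psi>\<bar> \<le> sqrt (1 / Suc n) * sqrt (Eform m \<psi> \<psi>)"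
  shows "\<exists>f. L2 \<Omega> f \<and> form_approx \<Omega> m \<phi> f"
proof -
  have diff: "test_fun \<Omega> (\<lambda>x. \<phi> n x - \<phi> k x)" for n k
    by (intro test_fun_diff \<phi>)
  have Q: "Eform m (\<lambda>x. \<phi> n x - \<phi> k x) (\<lambda>x. \<phi> n x - \<phi> k x) \<le> (sqrt (1 / Suc n) + sqrt (1 / Suc k))\<^sup>2" for n k
  proof -
    define \<psi> where "\<psi> = (\<lambda>x. \<phi> n x - \<phi> k x)"
    define q where "q = sqrt (Eform m \<psi> \<psi>)"
    have t: "test_fun UNIV (\<phi> n)" "test_fun UNIV (\<phi> k)" "test_fun UNIV \<psi>"
      using \<phi> diff[of n k] by (auto simp: \<psi>_def intro: test_fun_mono)
    have "q\<^sup>2 = Eform m \<psi> \<psi>"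
      by (simp add: q_def Eform_nonneg)
    also have "\<dots> = Eform m (\<phi> n) \<psi> - Eform m (\<phi> k) \<psi>"
      using Eform_lincomb[OF t, of m 1 "-1"] by (simp add: \<psi>_def)
    also have "\<dots> \<le> (sqrt (1 / Suc n) + sqrt (1 / Suc k)) * q"
      using EL[of \<psi> n] EL[of \<psi> k] diff[of n k] unfolding q_def[symmetric] \<psi>_def[symmetric]
      by (auto simp: distrib_right)
    finally have "q * q \<le> (sqrt (1 / Suc n) + sqrt (1 / Suc k)) * q"
      by (simp only: power2_eq_square)
    moreover have "0 \<le> q" by (simp add: q_def Eform_nonneg)
    ultimately have "q \<le> sqrt (1 / Suc n) + sqrt (1 / Suc k)"
      by (cases "q = 0") (simp_all only: mult_le_cancel_right, auto)
    then have "q\<^sup>2 \<le> (sqrt (1 / Suc n) + sqrt (1 / Suc k))\<^sup>2"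
      by (rule power_mono) (simp add: q_def Eform_nonneg)
    then show ?thesis
      by (simp add: q_def \<psi>_def Eform_nonneg)
  qed
  have Qc: "\<exists>M. \<forall>n\<ge>M. \<forall>k\<ge>M. Eform m (\<lambda>x. \<phi> n x - \<phi> k x) (\<lambda>x. \<phi> n x - \<phi> k x) < e" if "e > 0" for e
  proof -
    obtain M where M: "\<And>n. n \<ge> M \<Longrightarrow> sqrt (1 / Suc n) < sqrt e / 2"
      using LIMSEQ_D[OF tendsto_sqrt_inverse_Suc, of "sqrt e / 2"] \<open>e > 0\<close> by auto
    have "Eform m (\<lambda>x. \<phi> n x - \<phi> k x) (\<lambda>x. \<phi> n x - \<phi> k x) < e" if "n \<ge> M" "k \<ge> M" for n k
    proof -
      have "(sqrt (1 / Suc n) + sqrt (1 / Suc k))\<^sup>2 < (sqrt e)\<^sup>2"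
        using M[OF that(1)] M[OF that(2)] by (intro power_strict_mono) auto
      then show ?thesis using Q[of n k] \<open>e > 0\<close> by simp
    qed
    then show ?thesis by blast
  qed
  have sq: "L2_inner \<Omega> h h = (\<integral>x. (h x)\<^sup>2 \<partial>lebesgue_on \<Omega>)" for h
    by (simp add: L2_inner_eq open_\<Omega> power2_eq_square)
  have "\<exists>f. square_integrable (lebesgue_on \<Omega>) f \<and> (\<lambda>n. \<integral>x. (\<phi> n x - f x)\<^sup>2 \<partial>lebesgue_on \<Omega>) \<longlonglongrightarrow> 0"
  proof (rule square_integrable_complete)
    show "square_integrable (lebesgue_on \<Omega>) (\<phi> n)" for n
      using test_fun_L2[OF open_\<Omega> \<phi>] by (simp add: L2_iff open_\<Omega>)
    fix e :: real assume "e > 0"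
    then obtain M where M: "\<And>n k. n \<ge> M \<Longrightarrow> k \<ge> M \<Longrightarrow> Eform m (\<lambda>x. \<phi> n x - \<phi> k x) (\<lambda>x. \<phi> n x - \<phi> k x) < c * e"
      using Qc[of "c * e"] c by auto
    have "(\<integral>x. (\<phi> n x - \<phi> k x)\<^sup>2 \<partial>lebesgue_on \<Omega>) < e" if "n \<ge> M" "k \<ge> M" for n k
    proof -
      have "c * (\<integral>x. (\<phi> n x - \<phi> k x)\<^sup>2 \<partial>lebesgue_on \<Omega>) < c * e"
        using coercive[OF diff, of n k] M[OF that] by (simp add: L2_norm_power2 sq)
      then show ?thesis using c by simp
    qed
    then show "\<exists>N. \<forall>n\<ge>N. \<forall>k\<ge>N. (\<integral>x. (\<phi> n x - \<phi> k x)\<^sup>2 \<partial>lebesgue_on \<Omega>) < e"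
      by blast
  qed
  then obtain f where f: "L2 \<Omega> f" "(\<lambda>n. L2_inner \<Omega> (\<lambda>x. \<phi> n x - f x) (\<lambda>x. \<phi> n x - f x)) \<longlonglongrightarrow> 0"
    by (auto simp: L2_iff open_\<Omega> sq)
  have "(\<lambda>n. L2_norm \<Omega> (\<lambda>x. \<phi> n x - f x)) \<longlonglongrightarrow> 0"
    using tendsto_real_sqrt[OF f(2)] by (simp add: L2_norm_def)
  then show ?thesis
    using f(1) \<phi> Qc by (auto simp: form_approx_iff open_\<Omega>)
qed

text \<open>The graph of H_m is tested with every approximating sequence \<phi>' of f. Its
  difference u from the minimising one has q(u n) tending to 0 by closability, and q(\<psi> n) stays
  bounded, so q(\<phi>' n, \<psi> n) - <g, \<psi> n> still tends to 0.\<close>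

lemma Hm_of_minimising_sequence:
  assumes g: "L2 \<Omega> g" and f: "L2 \<Omega> f" and \<phi>: "form_approx \<Omega> m \<phi> f"
    and EL: "\<And>n \<psi>. test_fun \<Omega> \<psi> \<Longrightarrow> \<bar>Eform m (\<phi> n) \<psi> - L2_inner \<Omega> g \<psi>\<bar> \<le> sqrt (1 / Suc n) * sqrt (Eform m \<psi> \<psi>)"
  shows "Hm \<Omega> m f g"
proof -
  have "(\<lambda>n. Qm \<Omega> m (\<phi>' n) (\<psi> n)) \<longlonglongrightarrow> L2_inner \<Omega> g h"
    if h: "L2 \<Omega> h" and \<phi>': "form_approx \<Omega> m \<phi>' f" and \<psi>: "form_approx \<Omega> m \<psi> h" for h \<phi>' \<psi>
  proof -
    have t: "test_fun \<Omega> (\<phi> n)" "test_fun \<Omega> (\<phi>' n)" "test_fun \<Omega> (\<psi> n)" for n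
      using \<phi> \<phi>' \<psi> by (simp_all add: form_approx_iff open_\<Omega>)
    obtain B where B: "B \<ge> 0" "\<forall>\<^sub>F n in sequentially. Eform m (\<psi> n) (\<psi> n) \<le> B"
      using form_approx_bounded[OF open_\<Omega> \<psi>] by blast
    define u where "u n = (\<lambda>x. \<phi>' n x - \<phi> n x)" for n
    have u: "test_fun \<Omega> (u n)" for n
      unfolding u_def by (intro test_fun_diff t)
    have u0: "(\<lambda>n. Eform m (u n) (u n)) \<longlonglongrightarrow> 0"
      unfolding u_def by (intro form_approx_zero[OF open_\<Omega>] form_approx_diff[OF open_\<Omega> f \<phi>' \<phi>])
    have bound: "\<bar>Eform m (\<phi>' n) (\<psi> n) - L2_inner \<Omega> g (\<psi> n)\<bar>
        \<le> (sqrt (Eform m (u n) (u n)) + sqrt (1 / Suc n)) * sqrt (Eform m (\<psi> n) (\<psi> n))" for n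
    proof -
      have "Eform m (u n) (\<psi> n) = Eform m (\<phi>' n) (\<psi> n) - Eform m (\<phi> n) (\<psi> n)"
        using Eform_lincomb[of "\<phi>' n" "\<phi> n" "\<psi> n" m 1 "-1"] t[THEN test_fun_mono] by (simp add: u_def)
      moreover have "\<bar>Eform m (u n) (\<psi> n)\<bar> \<le> sqrt (Eform m (u n) (u n)) * sqrt (Eform m (\<psi> n) (\<psi> n))"
        using Eform_Cauchy_Schwarz[OF u t(3), of m n n]
        unfolding real_sqrt_mult[symmetric] by (metis real_sqrt_abs real_sqrt_le_mono)
      ultimately show ?thesis
        using EL[OF t(3), of n n] by (simp add: distrib_right)
    qed
    have ev: "\<forall>\<^sub>F n in sequentially. norm (Eform m (\<phi>' n) (\<psi> n) - L2_inner \<Omega> g (\<psi> n))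
        \<le> (sqrt (Eform m (u n) (u n)) + sqrt (1 / Suc n)) * sqrt B"
      using B(2)
    proof (rule eventually_mono)
      fix n assume "Eform m (\<psi> n) (\<psi> n) \<le> B"
      then have "(sqrt (Eform m (u n) (u n)) + sqrt (1 / Suc n)) * sqrt (Eform m (\<psi> n) (\<psi> n))
          \<le> (sqrt (Eform m (u n) (u n)) + sqrt (1 / Suc n)) * sqrt B"
        by (intro mult_left_mono) (auto simp: Eform_nonneg)
      then show "norm (Eform m (\<phi>' n) (\<psi> n) - L2_inner \<Omega> g (\<psi> n))
          \<le> (sqrt (Eform m (u n) (u n)) + sqrt (1 / Suc n)) * sqrt B"
        using bound[of n] by simp
    qed
    have "(\<lambda>n. (sqrt (Eform m (u n) (u n)) + sqrt (1 / Suc n)) * sqrt B) \<longlonglongrightarrow> (sqrt 0 + 0) * sqrt B"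
      by (intro tendsto_intros u0 tendsto_sqrt_inverse_Suc)
    then have "(\<lambda>n. Eform m (\<phi>' n) (\<psi> n) - L2_inner \<Omega> g (\<psi> n)) \<longlonglongrightarrow> 0"
      by (intro Lim_null_comparison[OF ev]) simp
    from tendsto_add[OF this form_approx_L2_inner[OF open_\<Omega> g h \<psi>]]
    show ?thesis by (simp add: Qm_eq_Eform open_\<Omega> t)
  qed
  then show ?thesis
    unfolding Hm_def form_dom_def form_val_def using f g \<phi> by blast
qed

text \<open>Testing H_m f = g with f itself identifies the limit of the form values as <g, f>. The
  result yields both injectivity and the bound 1/c for the inverse.\<close>

lemma Hm_bound:
  assumes "Hm \<Omega> m f g"
  shows "c * (L2_norm \<Omega> f)\<^sup>2 \<le> L2_inner \<Omega> g f"
proof -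
  obtain \<phi> where f: "L2 \<Omega> f" and \<phi>: "form_approx \<Omega> m \<phi> f"
    using assms by (auto simp: Hm_def form_dom_def)
  have "(\<lambda>n. Qm \<Omega> m (\<phi> n) (\<phi> n)) \<longlonglongrightarrow> L2_inner \<Omega> g f"
    using assms \<phi> unfolding Hm_def form_val_def by blast
  moreover have "(\<lambda>n. c * (L2_norm \<Omega> (\<phi> n))\<^sup>2) \<longlonglongrightarrow> c * (L2_norm \<Omega> f)\<^sup>2"
    by (intro tendsto_intros form_approx_L2_norm[OF open_\<Omega> f \<phi>])
  moreover have "c * (L2_norm \<Omega> (\<phi> n))\<^sup>2 \<le> Qm \<Omega> m (\<phi> n) (\<phi> n)" for n
    using \<phi> coercive by (simp add: form_approx_iff open_\<Omega> Qm_eq_Eform)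
  ultimately show ?thesis
    by (intro LIMSEQ_le) auto
qed

lemma zero_notin_spec_of_coercive: "zero_notin_spec \<Omega> m"
  unfolding zero_notin_spec_def
proof (rule conjI; (rule exI[of _ "1 / c"])?; intro allI impI)
  fix f assume "Hm \<Omega> m f (\<lambda>_. 0)"
  from Hm_bound[OF this] have "c * (L2_norm \<Omega> f)\<^sup>2 \<le> 0"
    by (simp add: L2_inner_def)
  then show "L2_norm \<Omega> f = 0"
    using c by (simp add: mult_le_0_iff)
next
  fix g assume g: "L2 \<Omega> g"
  obtain \<phi> where \<phi>: "\<And>n. test_fun \<Omega> (\<phi> n)"
    and EL: "\<And>n \<psi>. test_fun \<Omega> \<psi> \<Longrightarrow> \<bar>Eform m (\<phi> n) \<psi> - L2_inner \<Omega> g \<psi>\<bar> \<le> sqrt (1 / Suc n) * sqrt (Eform m \<psi> \<psi>)"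
    using ex_minimising_sequence[OF g] by blast
  obtain f where f: "L2 \<Omega> f" "form_approx \<Omega> m \<phi> f"
    using minimising_sequence_converges[OF \<phi> EL] by blast
  have H: "Hm \<Omega> m f g"
    by (rule Hm_of_minimising_sequence[OF g f EL])
  have "c * (L2_norm \<Omega> f)\<^sup>2 \<le> L2_norm \<Omega> g * L2_norm \<Omega> f"
    using Hm_bound[OF H] L2_Cauchy_Schwarz[OF open_\<Omega> g f(1)] by simp
  then have "c * L2_norm \<Omega> f \<le> L2_norm \<Omega> g"
    using L2_norm_nonneg[of \<Omega> f] L2_norm_nonneg[of \<Omega> g]
    by (cases "L2_norm \<Omega> f = 0") (auto simp: power2_eq_square)
  then have "L2_norm \<Omega> f \<le> 1 / c * L2_norm \<Omega> g"
    using c by (simp add: field_simps)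
  with H show "\<exists>f. Hm \<Omega> m f g \<and> L2_norm \<Omega> f \<le> 1 / c * L2_norm \<Omega> g"
    by blast
qed

end

text \<open>With \<open>H\<^sub>m f = \<phi>\<close>, Cauchy-Schwarz for the form gives
  \<open>\<parallel>\<phi>\<parallel>\<^sup>4 = q(f, \<phi>)\<^sup>2 \<le> q(f) q(\<phi>) = \<langle>\<phi>, f\<rangle> q(\<phi>) \<le> C \<parallel>\<phi>\<parallel>\<^sup>2 q(\<phi>)\<close>.\<close>
lemma coercive_of_zero_notin_spec:
  fixes \<Omega> :: "'a::euclidean_space set"
  assumes open_\<Omega>: "open \<Omega>" and "zero_notin_spec \<Omega> m"
  shows "\<exists>C. \<forall>\<phi>. test_fun \<Omega> \<phi> \<longrightarrow> (L2_norm \<Omega> \<phi>)\<^sup>2 \<le> C * Eform m \<phi> \<phi>"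
proof -
  obtain C where C: "\<And>g. L2 \<Omega> g \<Longrightarrow> \<exists>f. Hm \<Omega> m f g \<and> L2_norm \<Omega> f \<le> C * L2_norm \<Omega> g"
    using assms(2) unfolding zero_notin_spec_def by blast
  \<comment> \<open>The constant C is not known to be nonnegative; \<open>max C 0\<close> keeps the
    products monotone.\<close>
  have "(L2_norm \<Omega> \<phi>)\<^sup>2 \<le> max C 0 * Eform m \<phi> \<phi>" if \<phi>: "test_fun \<Omega> \<phi>" for \<phi>
  proof -
    obtain f where H: "Hm \<Omega> m f \<phi>" and fC: "L2_norm \<Omega> f \<le> C * L2_norm \<Omega> \<phi>"
      using C[OF test_fun_L2[OF open_\<Omega> \<phi>]] by blast
    then obtain u where f: "L2 \<Omega> f" and u: "form_approx \<Omega> m u f"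
      by (auto simp: Hm_def form_dom_def)
    have t: "test_fun \<Omega> (u n)" for n
      using u by (simp add: form_approx_iff open_\<Omega>)
    have 1: "(\<lambda>n. Eform m (u n) (u n)) \<longlonglongrightarrow> L2_inner \<Omega> \<phi> f"
      using H u unfolding Hm_def form_val_def by (simp add: Qm_eq_Eform[OF open_\<Omega>, symmetric] t)
    have 2: "(\<lambda>n. Eform m (u n) \<phi>) \<longlonglongrightarrow> L2_inner \<Omega> \<phi> \<phi>"
      using H u test_fun_form_dom[OF open_\<Omega> \<phi>] form_approx_const[OF open_\<Omega> \<phi>] unfolding Hm_def form_val_def
      by (simp add: Qm_eq_Eform[OF open_\<Omega>, symmetric] t \<phi>)
    have "(L2_inner \<Omega> \<phi> \<phi>)\<^sup>2 \<le> L2_inner \<Omega> \<phi> f * Eform m \<phi> \<phi>"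
    proof (rule LIMSEQ_le)
      show "(\<lambda>n. (Eform m (u n) \<phi>)\<^sup>2) \<longlonglongrightarrow> (L2_inner \<Omega> \<phi> \<phi>)\<^sup>2"
        by (intro tendsto_intros 2)
      show "(\<lambda>n. Eform m (u n) (u n) * Eform m \<phi> \<phi>) \<longlonglongrightarrow> L2_inner \<Omega> \<phi> f * Eform m \<phi> \<phi>"
        by (intro tendsto_intros 1)
    qed (use Eform_Cauchy_Schwarz[OF t \<phi>] in blast)
    also have "L2_inner \<Omega> \<phi> f * Eform m \<phi> \<phi> \<le> (L2_norm \<Omega> \<phi> * (max C 0 * L2_norm \<Omega> \<phi>)) * Eform m \<phi> \<phi>"
    proof (rule mult_right_mono)
      have "L2_inner \<Omega> \<phi> f \<le> L2_norm \<Omega> \<phi> * L2_norm \<Omega> f"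
        using L2_Cauchy_Schwarz[OF open_\<Omega> test_fun_L2[OF open_\<Omega> \<phi>] f] by simp
      also have "\<dots> \<le> L2_norm \<Omega> \<phi> * (max C 0 * L2_norm \<Omega> \<phi>)"
        using fC mult_right_mono[of C "max C 0" "L2_norm \<Omega> \<phi>"]
        by (intro mult_left_mono L2_norm_nonneg) (simp add: L2_norm_nonneg)
      finally show "L2_inner \<Omega> \<phi> f \<le> L2_norm \<Omega> \<phi> * (max C 0 * L2_norm \<Omega> \<phi>)" .
    qed (rule Eform_nonneg)
    finally have "(L2_norm \<Omega> \<phi>)\<^sup>2 * (L2_norm \<Omega> \<phi>)\<^sup>2 \<le> (L2_norm \<Omega> \<phi>)\<^sup>2 * (max C 0 * Eform m \<phi> \<phi>)"
      unfolding L2_norm_power2[symmetric] by (simp add: power2_eq_square mult_ac)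
    \<comment> \<open>The squared norm is cancelled; if it vanishes, the claim is the positivity of
      the form.\<close>
    then show ?thesis
      by (cases "L2_norm \<Omega> \<phi> = 0") (simp add: Eform_nonneg, simp only: mult_le_cancel_left_pos zero_less_power2 not_False_eq_True)
  qed
  then show ?thesis by blast
qed

subsection \<open>Bump functions\<close>

text \<open>The case k = 0 is the classical flat function exp(-1/t); the powers t^(-k) are the
  factors its derivatives produce, so the linear span of the family is closed under
  differentiation.\<close>

definition flat :: "nat \<Rightarrow> real \<Rightarrow> real" where
  "flat k t = (if t > 0 then inverse t ^ k * exp (- inverse t) else 0)"

lemma flat_has_derivative:
  "(flat k has_real_derivative (- real k * flat (Suc k) t + flat (Suc (Suc k)) t)) (at t)"
proof -
  consider "t > 0" | "t < 0" | "t = 0" by linarith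
  then show ?thesis
  proof cases
    case 1
    have "((\<lambda>t. inverse t ^ k * exp (- inverse t)) has_real_derivative
        (- real k * flat (Suc k) t + flat (Suc (Suc k)) t)) (at t)"
    proof (cases k)
      case 0
      then show ?thesis
        using 1 by (auto intro!: derivative_eq_intros simp: flat_def power2_eq_square)
    next
      case (Suc j)
      have inv: "(inverse has_real_derivative - (inverse t)\<^sup>2) (at t)"
        using 1 by (auto intro!: derivative_eq_intros simp: power2_eq_square)
      have "((\<lambda>t. exp (- inverse t)) has_real_derivative exp (- inverse t) * (inverse t)\<^sup>2) (at t)"
        by (rule DERIV_cong[OF DERIV_fun_exp[OF DERIV_minus[OF inv]]]) simp
      from DERIV_mult[OF DERIV_power_Suc[OF inv, of j] this]
      show ?thesis
        unfolding Suc by (rule DERIV_cong) (use 1 in \<open>simp add: flat_def power2_eq_square algebra_simps\<close>)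
    qed
    then show ?thesis
      by (rule has_field_derivative_transform_within_open[of _ _ _ "{0<..}"]) (use 1 in \<open>auto simp: flat_def\<close>)
  next
    case 2
    have "((\<lambda>t. 0) has_real_derivative 0) (at t)" by simp
    then have "(flat k has_real_derivative 0) (at t)"
      by (rule has_field_derivative_transform_within_open[of _ _ _ "{..<0}"]) (use 2 in \<open>auto simp: flat_def\<close>)
    then show ?thesis using 2 by (simp add: flat_def)
  next
    case 3
    \<comment> \<open>The difference quotient at 0 vanishes on the left. On the right, with y = 1/h,
      it is y^(k+1) exp(-y), which tends to 0 as y grows.\<close>
    have "((\<lambda>h. flat k h / h) \<longlongrightarrow> 0) (at 0)"
    proof (rule filterlim_split_at)
      have "((\<lambda>h. 0) \<longlongrightarrow> (0::real)) (at_left 0)" by simp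
      then show "((\<lambda>h. flat k h / h) \<longlongrightarrow> 0) (at_left 0)"
        by (rule Lim_transform_eventually) (auto simp: eventually_at_left_field flat_def intro!: exI[of _ "-1"])
      have "((\<lambda>h. inverse h ^ Suc k / exp (inverse h)) \<longlongrightarrow> (0::real)) (at_right 0)"
        using filterlim_compose[OF tendsto_power_div_exp_0 filterlim_inverse_at_top_right] .
      then show "((\<lambda>h. flat k h / h) \<longlongrightarrow> 0) (at_right 0)"
        by (rule Lim_transform_eventually)
           (auto simp: eventually_at_right_field flat_def exp_minus divide_inverse mult_ac intro!: exI[of _ 1])
    qed
    then show ?thesis
      by (simp add: 3 has_field_derivative_iff flat_def)
  qed
qed

text \<open>Chosen to be closed under directional derivatives.\<close>
inductive_set bump_algebra :: "('a::euclidean_space \<Rightarrow> real) set" where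
  const: "(\<lambda>x. a) \<in> bump_algebra"
| inner: "(\<lambda>x. x \<bullet> v) \<in> bump_algebra"
| flat: "(\<lambda>x. flat k (1 - x \<bullet> x)) \<in> bump_algebra"
| add: "f \<in> bump_algebra \<Longrightarrow> g \<in> bump_algebra \<Longrightarrow> (\<lambda>x. f x + g x) \<in> bump_algebra"
| mult: "f \<in> bump_algebra \<Longrightarrow> g \<in> bump_algebra \<Longrightarrow> (\<lambda>x. f x * g x) \<in> bump_algebra"

lemma smooth_bump_algebra:
  assumes "f \<in> bump_algebra" shows "smooth f"
  using assms
proof (rule smooth_coinduct)
  fix f :: "'a \<Rightarrow> real"
  assume "f \<in> bump_algebra"
  then show "\<exists>D. \<forall>x. (f has_derivative (\<lambda>v. D v x)) (at x) \<and> (\<forall>v. D v \<in> bump_algebra)"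
  proof induction
    case (const a)
    show ?case
      by (rule exI[of _ "\<lambda>v x. 0"]) (auto intro: bump_algebra.const)
  next
    case (inner v)
    show ?case
      by (rule exI[of _ "\<lambda>w x. w \<bullet> v"]) (auto intro!: bump_algebra.const derivative_eq_intros)
  next
    case (flat k)
    have "((\<lambda>x. flat k (1 - x \<bullet> x)) has_derivative
        (\<lambda>v. (- real k * flat (Suc k) (1 - x \<bullet> x) + flat (Suc (Suc k)) (1 - x \<bullet> x)) * (- 2 * (x \<bullet> v)))) (at x)" for x :: 'a
    proof -
      have "((\<lambda>x. 1 - x \<bullet> x) has_derivative (\<lambda>v. - 2 * (x \<bullet> v))) (at x)"
        by (auto intro!: derivative_eq_intros simp: inner_commute)
      from has_derivative_compose[OF this flat_has_derivative[THEN has_field_derivative_imp_has_derivative]]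
      show ?thesis .
    qed
    moreover have "(\<lambda>x. (- real k * flat (Suc k) (1 - x \<bullet> x) + flat (Suc (Suc k)) (1 - x \<bullet> x)) * (- 2 * (x \<bullet> v))) \<in> bump_algebra" for v :: 'a
      by (intro bump_algebra.intros)
    ultimately show ?case
      by (intro exI[of _ "\<lambda>v x. (- real k * flat (Suc k) (1 - x \<bullet> x) + flat (Suc (Suc k)) (1 - x \<bullet> x)) * (- 2 * (x \<bullet> v))"] allI conjI)
  next
    case (add f g)
    then obtain D E where "\<And>x. (f has_derivative (\<lambda>v. D v x)) (at x)" "\<And>v. D v \<in> bump_algebra"
      "\<And>x. (g has_derivative (\<lambda>v. E v x)) (at x)" "\<And>v. E v \<in> bump_algebra" by metis
    then show ?case
      by (intro exI[of _ "\<lambda>v x. D v x + E v x"]) (auto intro: has_derivative_add bump_algebra.add)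
  next
    case (mult f g)
    then obtain D E where "\<And>x. (f has_derivative (\<lambda>v. D v x)) (at x)" "\<And>v. D v \<in> bump_algebra"
      "\<And>x. (g has_derivative (\<lambda>v. E v x)) (at x)" "\<And>v. E v \<in> bump_algebra" by metis
    then show ?case using mult.hyps
      by (intro exI[of _ "\<lambda>v x. f x * E v x + D v x * g x"])
         (auto intro!: has_derivative_mult bump_algebra.add bump_algebra.mult)
  qed
qed

text \<open>The polynomial 1 - x \<bullet> x is positive exactly on the open unit ball and, unlike
  the norm, is smooth at the origin.\<close>

lemma ex_bump:
  "\<exists>b :: 'a::euclidean_space \<Rightarrow> real. smooth b \<and> (\<forall>x. b x \<noteq> 0 \<longleftrightarrow> x \<in> ball 0 1)"
proof (intro exI conjI allI)
  show "smooth (\<lambda>x::'a. flat 0 (1 - x \<bullet> x))"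
    by (intro smooth_bump_algebra bump_algebra.flat)
  show "flat 0 (1 - x \<bullet> x) \<noteq> 0 \<longleftrightarrow> x \<in> ball 0 1" for x :: 'a
    by (simp add: flat_def dot_square_norm power_less_one_iff)
qed

subsection \<open>Scaling\<close>

lemma scaled_has_derivative:
  fixes f :: "'a::euclidean_space \<Rightarrow> real"
  assumes "smooth f"
  shows "((\<lambda>x. a * f (c *\<^sub>R (x - p))) has_derivative (\<lambda>v. (a * c) * dderiv v f (c *\<^sub>R (x - p)))) (at x)"
proof -
  have "((\<lambda>x. c *\<^sub>R (x - p)) has_derivative (\<lambda>v. c *\<^sub>R v)) (at x)"
    by (auto intro!: derivative_eq_intros)
  from has_derivative_mult_right[OF has_derivative_compose[OF this smooth_has_derivative[OF assms]], of a]
  have "((\<lambda>x. a * f (c *\<^sub>R (x - p))) has_derivative (\<lambda>v. a * dderiv (c *\<^sub>R v) f (c *\<^sub>R (x - p)))) (at x)" .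
  then show ?thesis
    using linear_scale[OF has_derivative_linear[OF smooth_has_derivative[OF assms]]]
    by (simp add: mult.assoc)
qed

lemma smooth_scaled:
  fixes f :: "'a::euclidean_space \<Rightarrow> real"
  assumes "smooth f" shows "smooth (\<lambda>x. a * f (c *\<^sub>R (x - p)))"
proof (rule smooth_coinduct[where S = "{h. \<exists>a f. smooth f \<and> h = (\<lambda>x. a * f (c *\<^sub>R (x - p)))}"], goal_cases)
  case 1
  then show ?case using assms by blast
next
  case (2 h)
  then obtain a f where h: "smooth f" "h = (\<lambda>x. a * f (c *\<^sub>R (x - p)))" by blast
  show ?case
  proof (intro exI[of _ "\<lambda>v x. (a * c) * dderiv v f (c *\<^sub>R (x - p))"] allI conjI CollectI)
    show "(h has_derivative (\<lambda>v. (a * c) * dderiv v f (c *\<^sub>R (x - p)))) (at x)" for x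
      unfolding h(2) by (rule scaled_has_derivative[OF h(1)])
    show "\<exists>a' f'. smooth f' \<and> (\<lambda>x. (a * c) * dderiv v f (c *\<^sub>R (x - p))) = (\<lambda>x. a' * f' (c *\<^sub>R (x - p)))" for v
      using smooth_dderiv[OF h(1)] by blast
  qed
qed

lemma lborel_integral_scaled:
  fixes p :: "'a::euclidean_space" and F :: "'a \<Rightarrow> real"
  assumes "c \<noteq> 0" and F: "F \<in> borel_measurable borel"
  shows "(\<integral>x. F (c *\<^sub>R (x - p)) \<partial>lborel) = (\<integral>x. F x \<partial>lborel) / \<bar>c\<bar> ^ DIM('a)"
proof -
  note [measurable] = F
  have "(\<integral>x. F x \<partial>lborel) = (\<integral>x. F x \<partial>density (distr lborel borel (\<lambda>x. - (c *\<^sub>R p) + c *\<^sub>R x)) (\<lambda>_. ennreal (\<bar>c\<bar> ^ DIM('a))))"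
    using lborel_affine[OF assms(1), of "- (c *\<^sub>R p)"] by simp
  also have "\<dots> = \<bar>c\<bar> ^ DIM('a) * (\<integral>x. F (- (c *\<^sub>R p) + c *\<^sub>R x) \<partial>lborel)"
    by (subst integral_density) (simp_all add: integral_distr)
  finally show ?thesis
    using assms(1) by (simp add: algebra_simps)
qed

text \<open>Each derivative brings out one factor c in both arguments, hence c^(2m); the change of
  variables gives the volume factor. The prefactor a is generalised because it turns into a c under
  differentiation.\<close>

lemma Eform_scaled:
  fixes f g :: "'a::euclidean_space \<Rightarrow> real"
  assumes "c \<noteq> 0" "smooth f" "smooth g"
  shows "Eform m (\<lambda>x. a * f (c *\<^sub>R (x - p))) (\<lambda>x. a * g (c *\<^sub>R (x - p)))
    = a\<^sup>2 * c ^ (2 * m) * Eform m f g / \<bar>c\<bar> ^ DIM('a)"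
  using assms(2,3)
proof (induction m arbitrary: a f g)
  case 0
  have "(\<lambda>x. f x * g x) \<in> borel_measurable borel"
    by (intro borel_measurable_continuous_onI continuous_on_mult smooth_continuous 0)
  from lborel_integral_scaled[OF assms(1) this, of p]
  moreover have "(\<lambda>x. a * f (c *\<^sub>R (x - p)) * (a * g (c *\<^sub>R (x - p)))) = (\<lambda>x. a\<^sup>2 * (f (c *\<^sub>R (x - p)) * g (c *\<^sub>R (x - p))))"
    by (simp add: power2_eq_square mult_ac)
  ultimately show ?case by simp
next
  case (Suc m)
  have d: "dderiv b (\<lambda>x. a * h (c *\<^sub>R (x - p))) = (\<lambda>x. (a * c) * dderiv b h (c *\<^sub>R (x - p)))" if "smooth h" for h :: "'a \<Rightarrow> real" and b
    by (rule ext, rule dderiv_unique[OF scaled_has_derivative[OF that]])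
  have "Eform (Suc m) (\<lambda>x. a * f (c *\<^sub>R (x - p))) (\<lambda>x. a * g (c *\<^sub>R (x - p)))
      = (\<Sum>b\<in>Basis. (a * c)\<^sup>2 * c ^ (2 * m) * Eform m (dderiv b f) (dderiv b g) / \<bar>c\<bar> ^ DIM('a))"
    unfolding Eform.simps d[OF Suc.prems(1)] d[OF Suc.prems(2)]
    by (intro sum.cong refl Suc.IH smooth_dderiv Suc.prems)
  also have "\<dots> = a\<^sup>2 * c ^ (2 * Suc m) * Eform (Suc m) f g / \<bar>c\<bar> ^ DIM('a)"
    by (simp add: sum_distrib_left sum_divide_distrib power_mult_distrib power2_eq_square mult_ac)
  finally show ?case .
qed

lemma finite_inradius_of_coercive:
  fixes \<Omega> :: "'a::euclidean_space set"
  assumes "m \<ge> 1"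
    and coercive: "\<And>f. test_fun \<Omega> f \<Longrightarrow> (\<integral>x. (f x)\<^sup>2 \<partial>lborel) \<le> C * Eform m f f"
  shows "finite_inradius \<Omega>"
proof (rule ccontr)
  assume inf: "\<not> finite_inradius \<Omega>"
  obtain b :: "'a \<Rightarrow> real" where b: "smooth b" "\<And>x. b x \<noteq> 0 \<longleftrightarrow> x \<in> ball 0 1"
    using ex_bump by blast
  have tb: "test_fun UNIV b"
  proof (rule test_funI[OF b(1) compact_cball[of 0 1]])
    show "b x = 0" if "x \<notin> cball 0 1" for x
      using b(2)[of x] that by auto
  qed simp
  define \<beta> where "\<beta> = (\<integral>x. b x * b x \<partial>lborel)"
  have "\<beta> > 0"
  proof -
    have int: "integrable lborel (\<lambda>x. b x * b x)" by (rule test_fun_integrable_mult[OF tb tb])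
    have "\<beta> \<noteq> 0"
    proof
      assume "\<beta> = 0"
      then have "AE x in lborel. b x * b x = 0"
        unfolding \<beta>_def using int by (subst (asm) integral_nonneg_eq_0_iff_AE) auto
      then have "AE x in lborel. x \<notin> ball (0::'a) 1"
        by (rule eventually_mono) (use b(2) in auto)
      then have "emeasure lborel (ball (0::'a) 1) = 0"
        by (subst (asm) AE_iff_null_sets[symmetric]) auto
      then show False
        using content_ball_pos[of 1 "0::'a"] by (simp add: measure_def)
    qed
    then show ?thesis by (simp add: \<beta>_def less_le integral_nonneg_AE)
  qed
  \<comment> \<open>Here c is the reciprocal of the radius. The volume factor of the rescaled bump
    occurs in its norm and in its form, so it cancels and leaves c^(2m), which is at most c because
    c <= 1 and m >= 1.\<close>
  have key: "\<beta> \<le> \<bar>C\<bar> * Eform m b b * c" if c: "0 < c" "c \<le> 1" for c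
  proof -
    have "(SUP x\<in>\<Omega>. dist_bdry \<Omega> x) = \<infinity>"
      using inf unfolding finite_inradius_def infinity_ennreal_def by (simp only: top.not_eq_extremum[symmetric] not_not)
    then have "ennreal (1 / c) < (SUP x\<in>\<Omega>. dist_bdry \<Omega> x)"
      by (simp only: infinity_ennreal_def ennreal_less_top)
    then obtain p where p: "p \<in> \<Omega>" "ennreal (1 / c) < dist_bdry \<Omega> p"
      by (auto simp: less_SUP_iff)
    have sub: "cball p (1 / c) \<subseteq> \<Omega>"
    proof
      fix y assume y: "y \<in> cball p (1 / c)"
      show "y \<in> \<Omega>"
      proof (rule ccontr)
        assume "y \<notin> \<Omega>"
        then have "dist_bdry \<Omega> p \<le> ennreal (dist p y)"
          unfolding dist_bdry_def by (intro Inf_lower) blast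
        also have "\<dots> \<le> ennreal (1 / c)" using y by (intro ennreal_leI) simp
        finally show False using p(2) by simp
      qed
    qed
    define f where "f = (\<lambda>x. 1 * b (c *\<^sub>R (x - p)))"
    have f: "test_fun \<Omega> f"
    proof (rule test_funI[OF _ compact_cball sub])
      show "smooth f" unfolding f_def by (rule smooth_scaled[OF b(1)])
      fix x assume "x \<notin> cball p (1 / c)"
      then have "1 \<le> norm (c *\<^sub>R (x - p))"
        unfolding norm_scaleR using c by (simp add: dist_norm norm_minus_commute field_simps)
      then have "c *\<^sub>R (x - p) \<notin> ball 0 1"
        unfolding mem_ball_0 not_less .
      then show "f x = 0" using b(2)[of "c *\<^sub>R (x - p)"] unfolding f_def mult_1 by blast
    qed
    \<comment> \<open>The case j = 0 is the squared norm, j = m the form.\<close>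
    have E: "Eform j f f = c ^ (2 * j) * Eform j b b / \<bar>c\<bar> ^ DIM('a)" for j
      unfolding f_def using Eform_scaled[OF _ b(1) b(1), of c j 1 p] c by simp
    have "(\<integral>x. (f x)\<^sup>2 \<partial>lborel) \<le> C * Eform m f f"
      by (rule coercive[OF f])
    also have "(\<integral>x. (f x)\<^sup>2 \<partial>lborel) = \<beta> / \<bar>c\<bar> ^ DIM('a)"
      using E[of 0] by (simp add: power2_eq_square \<beta>_def)
    finally have "\<beta> \<le> C * (c ^ (2 * m) * Eform m b b)"
      using c by (simp add: E field_simps)
    also have "\<dots> \<le> \<bar>C\<bar> * (c * Eform m b b)"
      using c assms(1) power_decreasing[of 1 "2 * m" c]
      by (intro mult_mono mult_right_mono) (auto simp: Eform_nonneg)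
    finally show ?thesis by (simp add: mult_ac)
  qed
  define K where "K = \<bar>C\<bar> * Eform m b b"
  have "K \<ge> 0" by (simp add: K_def Eform_nonneg)
  \<comment> \<open>This makes K c at most \<beta> / 2, the contradiction; K + 1 in the denominator
    covers K = 0.\<close>
  define c where "c = min 1 (\<beta> / (2 * (K + 1)))"
  have "0 < c" "c \<le> 1" using \<open>\<beta> > 0\<close> \<open>K \<ge> 0\<close> by (auto simp: c_def)
  then have "\<beta> \<le> K * c" using key unfolding K_def by blast
  also have "\<dots> \<le> (K + 1) * (\<beta> / (2 * (K + 1)))"
    using \<open>K \<ge> 0\<close> \<open>0 < c\<close> by (intro mult_mono) (auto simp: c_def)
  also have "\<dots> = \<beta> / 2" using \<open>K \<ge> 0\<close> by (simp add: divide_simps)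
  finally show False using \<open>\<beta> > 0\<close> by simp
qed

theorem theorem3p3:
  fixes \<Omega> :: "'a::euclidean_space set" and m :: nat
  assumes "open \<Omega>" and "\<Omega> \<noteq> {}" and "connected \<Omega>" and "m \<ge> 1"
    and "m_regular \<Omega> m"
  shows "zero_notin_spec \<Omega> m \<longleftrightarrow> finite_inradius \<Omega>"
proof
  have norm: "(L2_norm \<Omega> f)\<^sup>2 = (\<integral>x. (f x)\<^sup>2 \<partial>lborel)" if "test_fun \<Omega> f" for f
    using L2_inner_test_fun[OF assms(1) that that] unfolding L2_norm_power2 by (simp add: power2_eq_square)
  {
    assume "zero_notin_spec \<Omega> m"
    then obtain C where "\<And>f. test_fun \<Omega> f \<Longrightarrow> (L2_norm \<Omega> f)\<^sup>2 \<le> C * Eform m f f"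
      using coercive_of_zero_notin_spec[OF assms(1)] by blast
    then show "finite_inradius \<Omega>"
      by (intro finite_inradius_of_coercive[OF assms(4), where C = C]) (simp add: norm)
  }
  assume "finite_inradius \<Omega>"
  then obtain c where c: "c > 0" "\<And>f. test_fun \<Omega> f \<Longrightarrow> c * (\<integral>x. (f x)\<^sup>2 \<partial>lborel) \<le> Eform m f f"
    using poincare_of_regular[OF assms(1,4,5)] by blast
  show "zero_notin_spec \<Omega> m"
    by (rule zero_notin_spec_of_coercive[OF assms(1) c(1)]) (simp add: norm c(2))
qed

end
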